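(* Let $N\ge 1$, $0<\theta\le 2$ and $1<\alpha<p$. Then there exists $\gamma_3>0$ such that, if $\mu$ is a nonnegative measurable function in $\mathbf{R}^N$ satisfying $$\sup_{x\in\mathbf{R}^N}\left[\frac{1}{|B(x,\sigma)|}\int_{B(x,\sigma)}\mu(y)^\alpha\,dy\right]^{\frac1\alpha}\le\gamma_3\,\sigma^{-\frac{\theta}{p-1}},\qquad 0<\sigma<T^{1/\theta},$$ for some $T>0$, then the Cauchy problem $\partial_t u+(-\Delta)^{\theta/2}u=u^p$, $u(0)=\mu$, possesses a solution in $\mathbf{R}^N\times[0,T)$ (in the sense of the context).
   Context: $B(x,r)=\{y\in\mathbf{R}^N:|x-y|<r\}$ and $|B(x,r)|$ is its volume. A nonnegative locally integrable function $\mu$ is identified with the Radon measure $\mu\,dx$. $G=G(x,t)$ denotes the fundamental solution of $\partial_t u+(-\Delta)^{\theta/2}u=0$ in $\mathbf{R}^N\times(0,\infty)$, i.e. the positive smooth kernel with $\int_{\mathbf{R}^N}G(x,t)e^{-i\xi\cdot x}\,dx=e^{-t|\xi|^\theta}$ (the Gauss kernel $(4\pi t)^{-N/2}e^{-|x|^2/4t}$ when $\theta=2$). For a Radon measure $\mu$ in $\mathbf{R}^N$ and $0<T\le\infty$, a nonnegative measurable function $u$ in $\mathbf{R}^N\times(0,T)$ is a solution of the Cauchy problem $\partial_t u+(-\Delta)^{\theta/2}u=u^p$, $u(0)=\mu$, in $\mathbf{R}^N\times[0,T)$ if $$\infty>u(x,t)=\int_{\mathbf{R}^N}G(x-y,t)\,d\mu(y)+\int_0^t\int_{\mathbf{R}^N}G(x-y,t-s)u(y,s)^p\,dy\,ds$$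 for almost all $x\in\mathbf{R}^N$ and $0<t<T$. *)

theory Defs
  imports "HOL-Analysis.Analysis"
begin

text \<open>Real powers on \<open>[0,\<infinity>]\<close>. Only positive exponents \<open>a\<close> are meant, so \<open>\<infinity>\<close> is sent to \<open>\<infinity>\<close>
  (and \<open>0\<close> to \<open>0\<close>).\<close>

definition ennpowr :: "ennreal \<Rightarrow> real \<Rightarrow> ennreal" where
  "ennpowr x a = (if x = \<infinity> then \<infinity> else ennreal (enn2real x powr a))"

text \<open>\<open>C\<^sup>k\<close> on an open set \<open>S\<close>: all directional derivatives of order at most \<open>k\<close> exist
  (as Frechet derivatives) and are continuous.\<close>

fun Ck_on :: "nat \<Rightarrow> 'a::real_normed_vector set \<Rightarrow> ('a \<Rightarrow> real) \<Rightarrow> bool" where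
  "Ck_on 0 S f \<longleftrightarrow> continuous_on S f"
| "Ck_on (Suc k) S f \<longleftrightarrow>
     (\<forall>z\<in>S. f differentiable (at z)) \<and> (\<forall>v. Ck_on k S (\<lambda>z. frechet_derivative f (at z) v))"

definition smooth_on :: "'a::real_normed_vector set \<Rightarrow> ('a \<Rightarrow> real) \<Rightarrow> bool" where
  "smooth_on S f \<longleftrightarrow> (\<forall>k. Ck_on k S f)"

text \<open>\<open>strip T\<close> is \<open>\<real>\<^sup>N \<times> (0,T)\<close> for \<open>0 < T \<le> \<infinity>\<close>.\<close>

definition strip :: "ennreal \<Rightarrow> ((real ^ 'n) \<times> real) set" where
  "strip T = {(x, t). 0 < t \<and> ennreal t < T}"

text \<open>\<open>G\<close> is the fundamental solution of \<open>\<partial>\<^sub>t u + (-\<Delta>)\<^bsup>\<theta>/2\<^esup> u = 0\<close> in \<open>\<real>\<^sup>N \<times> (0,\<infinity>)\<close>. These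
  conditions determine \<open>G\<close> on \<open>\<real>\<^sup>N \<times> (0,\<infinity>)\<close>; its values for \<open>t \<le> 0\<close> are irrelevant.\<close>

definition fundamental_solution :: "real \<Rightarrow> ((real ^ 'n) \<times> real \<Rightarrow> real) \<Rightarrow> bool" where
  "fundamental_solution \<theta> G \<longleftrightarrow>
     (\<forall>x t. 0 < t \<longrightarrow> 0 < G (x, t)) \<and>
     smooth_on (strip \<infinity>) G \<and>
     (\<forall>t>0. integrable lebesgue (\<lambda>x. G (x, t)) \<and>
        (\<forall>\<xi>. (LINT x|lebesgue. complex_of_real (G (x, t)) * exp (- \<i> * complex_of_real (\<xi> \<bullet> x)))
              = complex_of_real (exp (- t * norm \<xi> powr \<theta>))))"

text \<open>\<open>u\<close> solves \<open>\<partial>\<^sub>t u + (-\<Delta>)\<^bsup>\<theta>/2\<^esup> u = u\<^sup>p\<close>, \<open>u(0) = M\<close>, in \<open>\<real>\<^sup>N \<times> [0,T)\<close>, where \<open>\<theta>\<close> enters through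
  the fundamental solution \<open>G\<close>. ``Almost all'' refers to Lebesgue measure on \<open>\<real>\<^sup>N \<times> (0,T)\<close>;
  both integrals are integrals of nonnegative functions with values in \<open>[0,\<infinity>]\<close>.\<close>

definition is_solution ::
  "((real ^ 'n) \<times> real \<Rightarrow> real) \<Rightarrow> real \<Rightarrow> (real ^ 'n) measure \<Rightarrow> ennreal
     \<Rightarrow> ((real ^ 'n) \<times> real \<Rightarrow> ennreal) \<Rightarrow> bool" where
  "is_solution G p M T u \<longleftrightarrow>
     u \<in> borel_measurable (lebesgue_on (strip T)) \<and>
     (AE (x, t) in lebesgue_on (strip T).
        u (x, t) < \<infinity> \<and>
        u (x, t) = (\<integral>\<^sup>+y. ennreal (G (x - y, t)) \<partial>M)
          + (\<integral>\<^sup>+s\<in>{0<..<t}. (\<integral>\<^sup>+y. ennreal (G (x - y, t - s)) * ennpowr (u (y, s)) p \<partial>lebesgue) \<partial>lebesgue))"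

end

theory Submission
  imports Defs "HOL-Probability.Probability" "HOL-Real_Asymp.Real_Asymp"
begin

text \<open>Write \<open>S(t)\<close> for convolution with \<open>G(\<cdot>,t)\<close> and \<open>w(t) = (S(t) \<mu>\<^sup>\<alpha>)\<^bsup>1/\<alpha>\<^esup>\<close>. By Jensen \<open>S(t) \<mu> \<le> w(t)\<close>,
  and the averages hypothesis gives \<open>S(t) \<mu>\<^sup>\<alpha> \<le> C \<gamma>\<^sup>\<alpha> t\<^bsup>-\<alpha>/(p-1)\<^esup>\<close>. Splitting off the powers of
  \<open>S(s) \<mu>\<^sup>\<alpha>\<close> beyond the first and using the semigroup property,
  \<open>\<integral>\<^sub>0\<^sup>t S(t-s) (2w(s))\<^sup>p ds \<le> C' \<gamma>\<^bsup>p-1\<^esup> w(t)\<close>, where the time integral converges because \<open>\<alpha> > 1\<close>.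
  Hence \<open>2w\<close> is a supersolution for small \<open>\<gamma>\<close>, and monotone iteration below it converges to a solution.

  The bound on \<open>S(t) \<mu>\<^sup>\<alpha>\<close> needs no pointwise decay of \<open>G\<close>, only that \<open>G(\<cdot>,t)\<close> is radially nonincreasing:
  then \<open>G(z,t)\<close> is at most a constant times its mean over a ball around \<open>z\<close>, unless \<open>z\<close> is close to \<open>0\<close>.
  Radial monotonicity holds because \<open>exp (-t|\<xi>|\<^sup>\<theta>)\<close> is a limit of nonnegative combinations of the functions
  \<open>exp (-s|\<xi>|\<^sup>2)\<close>, whose Fourier transforms are Gaussians.\<close>

section \<open>Gaussians\<close>

text \<open>This is the characteristic function of the standard normal distribution after a
  rescaling of the variable.\<close>

lemma gaussian_char_1d:
  fixes a s :: real
  assumes s: "0 < s"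
  shows "has_bochner_integral lborel
           (\<lambda>x. exp (\<i> * complex_of_real (a * x)) * complex_of_real (exp (- s * x\<^sup>2)))
           (complex_of_real ((pi / s) powr (1/2) * exp (- a\<^sup>2 / (4 * s))))"
proof -
  \<comment> \<open>With this \<open>c\<close> the substitution y = c x turns exp (-y^2/2) into exp
    (-s x^2), and frequency a/c into a.\<close>
  define c where "c = sqrt (2 * s)"
  have c: "0 < c" "c\<^sup>2 = 2 * s" using s by (auto simp: c_def)
  let ?h = "\<lambda>y. std_normal_density y *\<^sub>R exp (\<i> * complex_of_real (a / c * y))"
  interpret real_distribution std_normal_distribution by (rule real_dist_normal_dist)
  have i1: "integrable std_normal_distribution (\<lambda>y. exp (\<i> * complex_of_real (a / c * y)))"
    by (rule integrable_const_bound[where B=1]) auto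
  have int: "integrable lborel ?h"
    using i1 by (subst (asm) integrable_density) (auto simp: scaleR_conv_of_real)
  have "char std_normal_distribution (a / c) = (LINT y|lborel. ?h y)"
    unfolding char_def by (subst integral_density) auto
  then have val: "(LINT y|lborel. ?h y) = complex_of_real (exp (- ((a / c)\<^sup>2) / 2))"
    by (simp add: char_std_normal_distribution)
  have "has_bochner_integral lborel ?h (complex_of_real (exp (- ((a / c)\<^sup>2) / 2)))"
    using int val by (simp add: has_bochner_integral_iff)
  then have "has_bochner_integral lborel (\<lambda>x. ?h (0 + c * x)) (complex_of_real (exp (- ((a / c)\<^sup>2) / 2)) /\<^sub>R \<bar>c\<bar>)"
    using lborel_has_bochner_integral_real_affine_iff[of c ?h _ 0] c by simp
  then have "has_bochner_integral lborel (\<lambda>x. complex_of_real (sqrt (2 * pi)) * ?h (0 + c * x))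
      (complex_of_real (sqrt (2 * pi)) * (complex_of_real (exp (- ((a / c)\<^sup>2) / 2)) /\<^sub>R \<bar>c\<bar>))"
    by (rule has_bochner_integral_mult_right)
  moreover have "complex_of_real (sqrt (2 * pi)) * ?h (0 + c * x)
     = exp (\<i> * complex_of_real (a * x)) * complex_of_real (exp (- s * x\<^sup>2))" for x
    using c by (simp add: std_normal_density_def scaleR_conv_of_real power_mult_distrib)
  moreover have "(complex_of_real (sqrt (2 * pi)) * (complex_of_real (exp (- ((a / c)\<^sup>2) / 2)) /\<^sub>R \<bar>c\<bar>))
     = complex_of_real ((pi / s) powr (1/2) * exp (- a\<^sup>2 / (4 * s)))"
  proof -
    have "sqrt (2 * pi) / c = sqrt (pi / s)"
      using s by (simp add: c_def real_sqrt_divide[symmetric])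
    then have "sqrt (2 * pi) * inverse c = (pi / s) powr (1/2)"
      using s by (metis powr_half_sqrt divide_inverse divide_nonneg_nonneg pi_ge_zero less_imp_le)
    moreover have "- ((a / c)\<^sup>2) / 2 = - a\<^sup>2 / (4 * s)"
      using c by (simp add: power_divide)
    ultimately have "sqrt (2 * pi) * (inverse c * exp (- ((a / c)\<^sup>2) / 2)) = (pi / s) powr (1/2) * exp (- a\<^sup>2 / (4 * s))"
      by (simp only: mult.assoc[symmetric])
    then show ?thesis
      using c by (simp only: scaleR_conv_of_real of_real_mult[symmetric] abs_of_pos)
  qed
  ultimately show ?thesis by (simp only:)
qed

text \<open>Both the character and the Gaussian factor over the coordinates, so the product form of
  Fubini reduces everything to dimension one.\<close>

lemma gaussian_char:
  fixes x :: "'a::euclidean_space"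
  assumes s: "0 < s"
  shows "has_bochner_integral lborel
           (\<lambda>\<xi>. exp (\<i> * complex_of_real (\<xi> \<bullet> x)) * complex_of_real (exp (- s * (norm \<xi>)\<^sup>2)))
           (complex_of_real ((pi / s) powr (DIM('a) / 2) * exp (- (norm x)\<^sup>2 / (4 * s))))"
proof -
  interpret P: product_sigma_finite "\<lambda>b::'a. lborel :: real measure" ..
  let ?f = "\<lambda>b y. exp (\<i> * complex_of_real ((x \<bullet> b) * y)) * complex_of_real (exp (- s * y\<^sup>2))"
  have int: "integrable lborel (?f b)" and
       val: "(LINT y|lborel. ?f b y) = complex_of_real ((pi / s) powr (1/2) * exp (- (x \<bullet> b)\<^sup>2 / (4 * s)))" for b
    using gaussian_char_1d[OF s, of "x \<bullet> b"] by (auto simp: has_bochner_integral_iff)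
  have norm2: "(norm y)\<^sup>2 = (\<Sum>b\<in>Basis. (y \<bullet> b)\<^sup>2)" for y :: 'a
    by (subst power2_norm_eq_inner, subst euclidean_inner) (simp add: power2_eq_square)
  have prodeq: "exp (\<i> * complex_of_real (\<xi> \<bullet> x)) * complex_of_real (exp (- s * (norm \<xi>)\<^sup>2))
        = (\<Prod>b\<in>Basis. ?f b (\<xi> \<bullet> b))" for \<xi> :: 'a
  proof -
    have "\<xi> \<bullet> x = (\<Sum>b\<in>Basis. (x \<bullet> b) * (\<xi> \<bullet> b))"
      by (subst euclidean_inner) (simp add: mult.commute)
    moreover have "- s * (norm \<xi>)\<^sup>2 = (\<Sum>b\<in>Basis. - s * (\<xi> \<bullet> b)\<^sup>2)"
      by (simp add: norm2 sum_distrib_left)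
    ultimately show ?thesis
      by (simp add: prod.distrib exp_sum sum_distrib_left)
  qed
  have m: "(\<lambda>f. \<Sum>b\<in>Basis. f b *\<^sub>R b) \<in> (\<Pi>\<^sub>M b\<in>Basis. lborel) \<rightarrow>\<^sub>M (borel :: 'a measure)"
    by measurable
  have inner: "(\<Sum>b\<in>Basis. f b *\<^sub>R b) \<bullet> b' = f b'" if "b' \<in> Basis" for f and b' :: 'a
    using that by (simp add: inner_sum_left inner_Basis if_distrib[of "\<lambda>r. _ * r"] cong: if_cong)
  have e: "(\<Prod>b\<in>Basis. ?f b ((\<Sum>b\<in>Basis. f b *\<^sub>R b) \<bullet> b)) = (\<Prod>b\<in>Basis. ?f b (f b))" for f
    by (intro prod.cong refl) (simp add: inner)
  have "has_bochner_integral (\<Pi>\<^sub>M b\<in>Basis. lborel) (\<lambda>f. \<Prod>b\<in>Basis. ?f b (f b))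
     (\<Prod>b\<in>Basis. complex_of_real ((pi / s) powr (1/2) * exp (- (x \<bullet> b)\<^sup>2 / (4 * s))))"
    unfolding has_bochner_integral_iff
    using P.product_integrable_prod[of Basis ?f] P.product_integral_prod[of Basis ?f] int val by simp
  also have "(\<Prod>b\<in>Basis. complex_of_real ((pi / s) powr (1/2) * exp (- (x \<bullet> b)\<^sup>2 / (4 * s))))
      = complex_of_real ((pi / s) powr (DIM('a) / 2) * exp (- (norm x)\<^sup>2 / (4 * s)))"
  proof -
    have "(\<Prod>b\<in>Basis. (pi / s) powr (1/2) * exp (- (x \<bullet> b)\<^sup>2 / (4 * s)))
        = ((pi / s) powr (1/2)) ^ DIM('a) * exp (\<Sum>b\<in>Basis. - (x \<bullet> b)\<^sup>2 / (4 * s))"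
      by (simp add: prod.distrib exp_sum)
    also have "((pi / s) powr (1/2)) ^ DIM('a) = (pi / s) powr (DIM('a) / 2)"
      using s by (simp add: powr_powr flip: powr_realpow)
    also have "(\<Sum>b\<in>Basis. - (x \<bullet> b)\<^sup>2 / (4 * s)) = - (norm x)\<^sup>2 / (4 * s)"
      by (simp add: norm2 sum_negf sum_divide_distrib[symmetric])
    finally show ?thesis by (simp only: of_real_prod[symmetric])
  qed
  finally have hb: "has_bochner_integral (\<Pi>\<^sub>M b\<in>Basis. lborel) (\<lambda>f. \<Prod>b\<in>Basis. ?f b (f b))
     (complex_of_real ((pi / s) powr (DIM('a) / 2) * exp (- (norm x)\<^sup>2 / (4 * s))))" .
  \<comment> \<open>\<open>lborel_eq\<close> presents \<open>lborel\<close> as the image of the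
    product of one-dimensional measures under the coordinate map, where the product formula
    \<open>hb\<close> lives.\<close>
  show ?thesis
    unfolding prodeq
    apply (subst lborel_eq)
    unfolding has_bochner_integral_iff
    apply (subst integrable_distr_eq[OF m], simp)
    apply (subst integral_distr[OF m], simp)
    using hb unfolding e has_bochner_integral_iff by simp
qed

lemma gaussian_cos:
  fixes x :: "'a::euclidean_space"
  assumes s: "0 < s"
  shows "has_bochner_integral lborel (\<lambda>\<xi>. cos (\<xi> \<bullet> x) * exp (- s * (norm \<xi>)\<^sup>2))
           ((pi / s) powr (DIM('a) / 2) * exp (- (norm x)\<^sup>2 / (4 * s)))"
proof -
  have "Re (exp (\<i> * complex_of_real r)) = cos r" for r
    by (simp add: Re_exp)
  then show ?thesis
    using has_bochner_integral_bounded_linear[OF bounded_linear_Re gaussian_char[OF s, of x]]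
    by simp
qed

lemma integrable_gaussian:
  assumes "0 < s"
  shows "integrable lborel (\<lambda>\<xi>::'a::euclidean_space. exp (- s * (norm \<xi>)\<^sup>2))"
  using gaussian_cos[OF assms, of "0::'a"] by (simp add: has_bochner_integral_iff)

text \<open>The Gauss kernel at time \<open>s\<close>. Here it serves as a mollifier with
  \<open>s\<close> tending to 0, for every \<theta>.\<close>

definition gauss :: "real \<Rightarrow> 'a::euclidean_space \<Rightarrow> real" where
  "gauss s x = (4 * pi * s) powr (- real DIM('a) / 2) * exp (- (norm x)\<^sup>2 / (4 * s))"

lemma gauss_nonneg [simp]: "0 \<le> gauss s x"
  by (simp add: gauss_def)

lemma borel_measurable_gauss [measurable]: "gauss s \<in> borel_measurable borel"
  unfolding gauss_def by measurable

lemma has_integral_gauss: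
  assumes s: "0 < s"
  shows "has_bochner_integral lborel (gauss s :: 'a::euclidean_space \<Rightarrow> real) 1"
proof -
  have e: "gauss s x = (4 * pi * s) powr (- real DIM('a) / 2) * (cos (x \<bullet> 0) * exp (- (1 / (4 * s)) * (norm x)\<^sup>2))" for x :: 'a
    by (simp add: gauss_def)
  have "has_bochner_integral lborel (gauss s :: 'a \<Rightarrow> real)
     ((4 * pi * s) powr (- real DIM('a) / 2) * ((pi / (1 / (4 * s))) powr (DIM('a) / 2) * exp (- (norm (0::'a))\<^sup>2 / (4 * (1 / (4 * s))))))"
    unfolding e using s by (intro has_bochner_integral_mult_right gaussian_cos) simp
  also have "(4 * pi * s) powr (- real DIM('a) / 2) * ((pi / (1 / (4 * s))) powr (DIM('a) / 2) * exp (- (norm (0::'a))\<^sup>2 / (4 * (1 / (4 * s))))) = 1"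
    using s by (simp add: powr_minus mult.commute mult.left_commute)
  finally show ?thesis .
qed

text \<open>In this form a convolution of \<open>G\<close> with a Gaussian can be moved to the
  Fourier side, where \<open>G\<close> is known explicitly.\<close>

lemma gauss_eq_cos:
  assumes s: "0 < s"
  shows "gauss s (x::'a::euclidean_space)
      = (LINT \<xi>|lborel. cos (\<xi> \<bullet> x) * exp (- s * (norm \<xi>)\<^sup>2)) / (2 * pi) ^ DIM('a)"
proof -
  \<comment> \<open>The constants match because 2 pi is the square root of (4 pi s) (pi /
    s).\<close>
  have "(4 * pi * s) powr (- real DIM('a) / 2) * (2 * pi) ^ DIM('a) = (pi / s) powr (DIM('a) / 2)"
  proof -
    have "2 * pi = ((4 * pi * s) * (pi / s)) powr (1/2)"
      using s by (simp add: powr_half_sqrt real_sqrt_mult)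
    then have "(2 * pi) ^ DIM('a) = ((4 * pi * s) * (pi / s)) powr (DIM('a) / 2)"
      using s by (metis powr_gt_zero powr_realpow powr_powr mult.commute times_divide_eq_right mult.right_neutral less_numeral_extra(1) pi_gt_zero zero_less_mult_iff zero_less_numeral)
    also have "\<dots> = (4 * pi * s) powr (DIM('a) / 2) * (pi / s) powr (DIM('a) / 2)"
      using s by (subst powr_mult) auto
    finally have eq: "(2 * pi) ^ DIM('a) = (4 * pi * s) powr (DIM('a) / 2) * (pi / s) powr (DIM('a) / 2)" .
    have "(4 * pi * s) powr (- real DIM('a) / 2) * (4 * pi * s) powr (DIM('a) / 2) = 1"
      using s by (simp add: powr_add[symmetric])
    then show ?thesis unfolding eq by (simp only: mult.assoc[symmetric] mult_1_left)
  qed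
  then have "gauss s x * (2 * pi) ^ DIM('a) = (pi / s) powr (DIM('a) / 2) * exp (- (norm x)\<^sup>2 / (4 * s))"
    by (simp add: gauss_def mult_ac)
  also have "\<dots> = (LINT \<xi>|lborel. cos (\<xi> \<bullet> x) * exp (- s * (norm \<xi>)\<^sup>2))"
    using gaussian_cos[OF s, of x] by (simp add: has_bochner_integral_iff)
  finally show ?thesis by (simp add: field_simps)
qed

section \<open>Mixtures of Gaussians\<close>

text \<open>The argument \<open>u\<close> stands for \<open>|\<xi>|\<^sup>2\<close>. Limits are only required for \<open>u > 0\<close>, since \<open>\<xi> = 0\<close> is a
  null set and the binomial series below need not be controlled there.\<close>

inductive gaussian_mixture :: "(real \<Rightarrow> real) \<Rightarrow> bool" where
  gaussian_mixture_base: "0 \<le> s \<Longrightarrow> gaussian_mixture (\<lambda>u. exp (- s * u))"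
| gaussian_mixture_add: "gaussian_mixture f \<Longrightarrow> gaussian_mixture g \<Longrightarrow> gaussian_mixture (\<lambda>u. f u + g u)"
| gaussian_mixture_scale: "0 \<le> c \<Longrightarrow> gaussian_mixture f \<Longrightarrow> gaussian_mixture (\<lambda>u. c * f u)"
| gaussian_mixture_lim: "(\<And>n. gaussian_mixture (f n)) \<Longrightarrow> g \<in> borel_measurable borel \<Longrightarrow> (\<And>n u. 0 < u \<Longrightarrow> f n u \<le> B)
     \<Longrightarrow> (\<And>u. 0 < u \<Longrightarrow> (\<lambda>n. f n u) \<longlonglongrightarrow> g u) \<Longrightarrow> gaussian_mixture g" for f :: "nat \<Rightarrow> real \<Rightarrow> real" and g B

lemma gaussian_mixture_measurable: "gaussian_mixture h \<Longrightarrow> h \<in> borel_measurable borel"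
  by (induction rule: gaussian_mixture.induct) auto

lemma gaussian_mixture_nonneg: "gaussian_mixture h \<Longrightarrow> 0 < u \<Longrightarrow> 0 \<le> h u"
proof (induction rule: gaussian_mixture.induct)
  case (gaussian_mixture_lim f g B)
  show ?case by (rule LIMSEQ_le_const[OF gaussian_mixture_lim.hyps(4)[OF \<open>0 < u\<close>]]) (use gaussian_mixture_lim in auto)
qed auto

lemma gaussian_mixture_bounded: "gaussian_mixture h \<Longrightarrow> \<exists>B. \<forall>u>0. h u \<le> B"
proof (induction rule: gaussian_mixture.induct)
  case (gaussian_mixture_base s)
  then show ?case by (intro exI[of _ 1]) auto
next
  case (gaussian_mixture_add f g)
  then obtain B1 B2 where "\<forall>u>0. f u \<le> B1" "\<forall>u>0. g u \<le> B2" by auto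
  then show ?case by (intro exI[of _ "B1 + B2"]) (auto intro: add_mono)
next
  case (gaussian_mixture_scale c f)
  then obtain B1 where "\<forall>u>0. f u \<le> B1" by auto
  then show ?case using gaussian_mixture_scale by (intro exI[of _ "c * B1"]) (auto intro: mult_left_mono)
next
  case (gaussian_mixture_lim f g B)
  have "g u \<le> B" if "0 < u" for u
    by (rule LIMSEQ_le_const2[OF gaussian_mixture_lim.hyps(4)[OF that]]) (use gaussian_mixture_lim that in auto)
  then show ?case by auto
qed

text \<open>Induction on \<open>f\<close>, with an inner induction on \<open>g\<close> when
  \<open>f\<close> is a single exponential. In the limit cases the bound required of the products
  comes from nonnegativity and boundedness of mixtures on u > 0.\<close>

lemma gaussian_mixture_mult:
  assumes "gaussian_mixture f" "gaussian_mixture g" shows "gaussian_mixture (\<lambda>u. f u * g u)"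
  using assms(1)
proof (induction rule: gaussian_mixture.induct)
  case (gaussian_mixture_base s)
  show ?case using assms(2)
  proof (induction rule: gaussian_mixture.induct)
    case (gaussian_mixture_base r)
    then show ?case using gaussian_mixture.gaussian_mixture_base[of "s + r"] \<open>0 \<le> s\<close> by (simp add: algebra_simps flip: exp_add)
  next
    case (gaussian_mixture_add f g)
    then show ?case using gaussian_mixture.gaussian_mixture_add by (fastforce simp: algebra_simps)
  next
    case (gaussian_mixture_scale c f)
    then show ?case using gaussian_mixture.gaussian_mixture_scale[of c] by (fastforce simp: algebra_simps)
  next
    case (gaussian_mixture_lim f g B)
    have bd: "exp (- s * u) * f n u \<le> B" if "0 < u" for n u
    proof -
      have "exp (- s * u) * f n u \<le> 1 * f n u"
        using gaussian_mixture_nonneg[OF gaussian_mixture_lim.hyps(1) that] that \<open>0 \<le> s\<close> by (intro mult_right_mono) auto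
      then show ?thesis using gaussian_mixture_lim.hyps(3)[OF that, of n] by simp
    qed
    have me: "(\<lambda>u. exp (- s * u) * g u) \<in> borel_measurable borel"
      using gaussian_mixture_lim.hyps(2) by measurable
    have li: "(\<lambda>n. exp (- s * u) * f n u) \<longlonglongrightarrow> exp (- s * u) * g u" if "0 < u" for u
      by (intro tendsto_mult tendsto_const gaussian_mixture_lim.hyps(4) that)
    show ?case
      by (rule gaussian_mixture.gaussian_mixture_lim[OF gaussian_mixture_lim.IH me bd li])
  qed
next
  case (gaussian_mixture_add f g)
  then show ?case using gaussian_mixture.gaussian_mixture_add by (fastforce simp: algebra_simps)
next
  case (gaussian_mixture_scale c f)
  then show ?case using gaussian_mixture.gaussian_mixture_scale[of c] by (fastforce simp: algebra_simps)
next
  case (gaussian_mixture_lim f h B)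
  obtain Bg where Bg: "\<forall>u>0. g u \<le> Bg" using gaussian_mixture_bounded[OF assms(2)] by auto
  have bd: "f n u * g u \<le> B * Bg" if "0 < u" for n u
    using gaussian_mixture_lim.hyps(3)[OF that, of n] Bg that gaussian_mixture_nonneg[OF gaussian_mixture_lim.hyps(1) that] gaussian_mixture_nonneg[OF assms(2) that]
    by (intro mult_mono) (auto intro: order_trans)
  have me: "(\<lambda>u. h u * g u) \<in> borel_measurable borel"
    using gaussian_mixture_lim.hyps(2) gaussian_mixture_measurable[OF assms(2)] by measurable
  have li: "(\<lambda>n. f n u * g u) \<longlonglongrightarrow> h u * g u" if "0 < u" for u
    by (intro tendsto_mult tendsto_const gaussian_mixture_lim.hyps(4) that)
  show ?case
    by (rule gaussian_mixture.gaussian_mixture_lim[OF gaussian_mixture_lim.IH me bd li])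
qed

lemma gaussian_mixture_const: "0 \<le> c \<Longrightarrow> gaussian_mixture (\<lambda>_. c)"
  using gaussian_mixture_scale[OF _ gaussian_mixture_base[of 0]] by simp

lemma gaussian_mixture_power: "gaussian_mixture f \<Longrightarrow> gaussian_mixture (\<lambda>u. f u ^ k)"
  by (induction k) (auto intro: gaussian_mixture_mult gaussian_mixture_const)

lemma gaussian_mixture_sum: "(\<And>k. k \<in> K \<Longrightarrow> gaussian_mixture (f k)) \<Longrightarrow> gaussian_mixture (\<lambda>u. \<Sum>k\<in>K. f k u)"
  by (induction K rule: infinite_finite_induct) (auto intro: gaussian_mixture_add gaussian_mixture_const)

text \<open>The partial sums of the exponential series have nonnegative coefficients, so they are
  mixtures, and they stay below exp (f u).\<close>

lemma gaussian_mixture_exp: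
  assumes f: "gaussian_mixture f" shows "gaussian_mixture (\<lambda>u. exp (f u))"
proof -
  obtain B where B: "\<forall>u>0. f u \<le> B" using gaussian_mixture_bounded[OF f] by auto
  have s: "(\<lambda>k. (1 / fact k) * f u ^ k) sums exp (f u)" for u
    using exp_converges[of "f u"] by (simp add: field_simps)
  show ?thesis
  proof (rule gaussian_mixture_lim[of "\<lambda>n u. \<Sum>k<n. (1 / fact k) * f u ^ k" _ "exp B"])
    show "gaussian_mixture (\<lambda>u. \<Sum>k<n. (1 / fact k) * f u ^ k)" for n
      by (intro gaussian_mixture_sum gaussian_mixture_scale gaussian_mixture_power f) auto
    show "(\<lambda>u. exp (f u)) \<in> borel_measurable borel"
      using gaussian_mixture_measurable[OF f] by measurable
    show "(\<Sum>k<n. (1 / fact k) * f u ^ k) \<le> exp B" if "0 < u" for n u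
    proof -
      have "(\<Sum>k<n. (1 / fact k) * f u ^ k) \<le> exp (f u)"
        unfolding sums_unique[OF s] using gaussian_mixture_nonneg[OF f that]
        by (intro sum_le_suminf sums_summable[OF s]) auto
      also have "\<dots> \<le> exp B" using B that by simp
      finally show ?thesis .
    qed
    show "(\<lambda>n. \<Sum>k<n. (1 / fact k) * f u ^ k) \<longlonglongrightarrow> exp (f u)" for u
      using s unfolding sums_def .
  qed
qed

text \<open>The term of index 1 is -b, and passing from index n \<ge> 1 to n + 1 multiplies by (n -
  b) / (n + 1), which is nonnegative because b \<le> 1.\<close>

lemma alternating_gbinomial_nonpos:
  fixes b :: real
  assumes "0 < b" "b \<le> 1"
  shows "(b gchoose (Suc k)) * (-1) ^ Suc k \<le> 0"
proof (induction k)
  case 0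
  then show ?case using assms by simp
next
  case (Suc k)
  have "(b gchoose Suc (Suc k)) = (b gchoose (Suc k)) * (b - Suc k) / (Suc (Suc k))"
    unfolding gbinomial_prod_rev by (simp add: field_simps)
  moreover have "X * (b - m) / n * ((-1) * P) = (X * P) * ((m - b) / n)" for X m n P :: real
    by (simp add: divide_inverse algebra_simps)
  ultimately have e: "(b gchoose Suc (Suc k)) * (-1) ^ Suc (Suc k)
      = ((b gchoose (Suc k)) * (-1) ^ Suc k) * ((Suc k - b) / (Suc (Suc k)))"
    by (simp only: power_Suc[of "-1" "Suc k"])
  have "0 \<le> (Suc k - b) / (Suc (Suc k))" using assms by simp
  with Suc show ?case unfolding e by (rule mult_nonpos_nonneg)
qed

text \<open>With \<open>r = exp (-eu)\<close>, the power series of \<open>1 - (1 - r)\<^sup>b\<close> has nonnegative coefficients for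
  \<open>0 < b \<le> 1\<close>.\<close>

lemma gaussian_mixture_one_minus_powr:
  fixes b e :: real
  assumes b: "0 < b" "b \<le> 1" and e: "0 < e"
  shows "gaussian_mixture (\<lambda>u. 1 - (1 - exp (- e * u)) powr b)"
proof -
  \<comment> \<open>\<open>d k\<close> is the coefficient of r^k in 1 - (1 - r)^b; the constant
    terms cancel, hence the value 0 at k = 0.\<close>
  define d where "d k = (if k = 0 then 0 else - ((b gchoose k) * (-1) ^ k))" for k :: nat
  have d: "0 \<le> d k" for k
    using alternating_gbinomial_nonpos[OF b, of "k - 1"] by (cases k) (auto simp: d_def)
  have s: "(\<lambda>k. d k * exp (- e * u) ^ k) sums (1 - (1 - exp (- e * u)) powr b)" if "0 < u" for u
  proof -
    define r where "r = exp (- e * u)"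
    \<comment> \<open>The strict bound r < 1, available because u > 0, puts -r inside the disc of
      convergence of the binomial series.\<close>
    have r: "0 < r" "r < 1" using e that by (auto simp: r_def)
    have "(\<lambda>k. (if k = 0 then 1 else 0) - (b gchoose k) * (- r) ^ k) sums (1 - (1 + - r) powr b)"
      using r by (intro sums_diff gen_binomial_real sums_single) auto
    moreover have "(if k = 0 then 1 else 0) - (b gchoose k) * (- r) ^ k = d k * r ^ k" for k
      by (auto simp: d_def power_minus[of r])
    ultimately show ?thesis by (simp add: r_def)
  qed
  show ?thesis
  proof (rule gaussian_mixture_lim[of "\<lambda>n u. \<Sum>k<n. d k * exp (- e * u) ^ k" _ 1])
    show "gaussian_mixture (\<lambda>u. \<Sum>k<n. d k * exp (- e * u) ^ k)" for n
      using e d by (intro gaussian_mixture_sum gaussian_mixture_scale gaussian_mixture_power gaussian_mixture_base) auto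
    show "(\<lambda>u. 1 - (1 - exp (- e * u)) powr b) \<in> borel_measurable borel" by measurable
    show "(\<Sum>k<n. d k * exp (- e * u) ^ k) \<le> 1" if "0 < u" for n u
    proof -
      have "(\<Sum>k<n. d k * exp (- e * u) ^ k) \<le> 1 - (1 - exp (- e * u)) powr b"
        unfolding sums_unique[OF s[OF that]] using d
        by (intro sum_le_suminf sums_summable[OF s[OF that]]) auto
      then show ?thesis by (smt (verit) powr_ge_zero)
    qed
    show "(\<lambda>n. \<Sum>k<n. d k * exp (- e * u) ^ k) \<longlonglongrightarrow> 1 - (1 - exp (- e * u)) powr b" if "0 < u" for u
      using s[OF that] unfolding sums_def .
  qed
qed

text \<open>\<open>u\<^sup>b\<close> is the limit of \<open>((1 - exp (-eu)) / e)\<^sup>b\<close> as \<open>e\<close> tends to \<open>0\<close>.\<close>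

lemma gaussian_mixture_stable:
  fixes b t :: real
  assumes b: "0 < b" "b \<le> 1" and t: "0 < t"
  shows "gaussian_mixture (\<lambda>u. exp (- t * u powr b))"
proof -
  define e where "e n = 1 / real (Suc n)" for n
  define f where "f n u = exp (- t * ((1 - exp (- e n * u)) / e n) powr b)" for n u
  have e: "0 < e n" for n by (simp add: e_def)
  \<comment> \<open>With r = exp (-eu), the exponent -t ((1 - r) / e)^b is the constant -t / e^b
    plus a nonnegative multiple of the mixture 1 - (1 - r)^b. So the approximant is a positive
    constant times the exponential of a mixture.\<close>
  show ?thesis
  proof (rule gaussian_mixture_lim[of "\<lambda>n u. exp (- (t / e n powr b)) * exp ((t / e n powr b) * (1 - (1 - exp (- e n * u)) powr b))" _ 1])
    show "gaussian_mixture (\<lambda>u. exp (- (t / e n powr b)) * exp ((t / e n powr b) * (1 - (1 - exp (- e n * u)) powr b)))" for n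
      using t e by (intro gaussian_mixture_scale gaussian_mixture_exp gaussian_mixture_one_minus_powr b) auto
    have eq: "exp (- (t / e n powr b)) * exp ((t / e n powr b) * (1 - (1 - exp (- e n * u)) powr b)) = f n u"
      if "0 < u" for n u
    proof -
      have "0 \<le> 1 - exp (- e n * u)" using e[of n] that by simp
      then have "((1 - exp (- e n * u)) / e n) powr b = (1 - exp (- e n * u)) powr b / e n powr b"
        using e[of n] by (simp add: powr_divide)
      then show ?thesis by (simp add: f_def algebra_simps flip: exp_add)
    qed
    show "exp (- (t / e n powr b)) * exp ((t / e n powr b) * (1 - (1 - exp (- e n * u)) powr b)) \<le> 1"
      if "0 < u" for n u
      using eq[OF that] t by (simp add: f_def)
    show "(\<lambda>n. exp (- (t / e n powr b)) * exp ((t / e n powr b) * (1 - (1 - exp (- e n * u)) powr b)))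
        \<longlonglongrightarrow> exp (- t * u powr b)" if u: "0 < u" for u
    proof -
      have "(\<lambda>n. (1 - exp (- e n * u)) / e n) \<longlonglongrightarrow> u"
        unfolding e_def using u by real_asymp
      then have "(\<lambda>n. f n u) \<longlonglongrightarrow> exp (- t * u powr b)"
        unfolding f_def using u by (intro tendsto_intros) auto
      then show ?thesis by (simp only: eq[OF u])
    qed
  qed measurable
qed

text \<open>A mixture is only bounded (constants are mixtures), so the Gaussian factor with d > 0
  supplies the integrability.\<close>

lemma gaussian_mixture_integrable:
  fixes x :: "'a::euclidean_space"
  assumes h: "gaussian_mixture h" and d: "0 < d"
  shows "integrable lborel (\<lambda>\<xi>::'a. cos (\<xi> \<bullet> x) * (exp (- d * (norm \<xi>)\<^sup>2) * h ((norm \<xi>)\<^sup>2)))"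
proof -
  obtain B where B: "\<forall>u>0. h u \<le> B" using gaussian_mixture_bounded[OF h] by auto
  have [measurable]: "h \<in> borel_measurable borel" by (rule gaussian_mixture_measurable[OF h])
  show ?thesis
  proof (rule Bochner_Integration.integrable_bound)
    show "integrable lborel (\<lambda>\<xi>::'a. B * exp (- d * (norm \<xi>)\<^sup>2))"
      using integrable_gaussian[OF d, where 'a='a] by simp
    have "norm (cos (\<xi> \<bullet> x) * (exp (- d * (norm \<xi>)\<^sup>2) * h ((norm \<xi>)\<^sup>2))) \<le> norm (B * exp (- d * (norm \<xi>)\<^sup>2))"
      if "\<xi> \<noteq> 0" for \<xi> :: 'a
    proof -
      have "0 \<le> h ((norm \<xi>)\<^sup>2)" "h ((norm \<xi>)\<^sup>2) \<le> B" using that B gaussian_mixture_nonneg[OF h] by auto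
      then have "\<bar>cos (\<xi> \<bullet> x)\<bar> * (exp (- d * (norm \<xi>)\<^sup>2) * h ((norm \<xi>)\<^sup>2)) \<le> 1 * (exp (- d * (norm \<xi>)\<^sup>2) * B)"
        by (intro mult_mono) auto
      then show ?thesis using \<open>0 \<le> h _\<close> \<open>h _ \<le> B\<close> by (simp add: abs_mult mult.commute)
    qed
    then show "AE \<xi> in lborel. norm (cos (\<xi> \<bullet> x) * (exp (- d * (norm \<xi>)\<^sup>2) * h ((norm \<xi>)\<^sup>2))) \<le> norm (B * exp (- d * (norm \<xi>)\<^sup>2))"
      using AE_lborel_singleton[of "0::'a"] by (auto elim!: eventually_mono)
  qed measurable
qed

text \<open>For a single exponential the integral is itself a Gaussian in the space variable, which
  decreases with the norm. Sums, nonnegative multiples and dominated limits preserve the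
  inequality.\<close>

lemma gaussian_mixture_cos_antimono:
  fixes x y :: "'a::euclidean_space"
  assumes h: "gaussian_mixture h" and d: "0 < d" and xy: "norm x \<le> norm y"
  shows "(LINT \<xi>|lborel. cos (\<xi> \<bullet> y) * (exp (- d * (norm \<xi>)\<^sup>2) * h ((norm \<xi>)\<^sup>2)))
       \<le> (LINT \<xi>|lborel. cos (\<xi> \<bullet> x) * (exp (- d * (norm \<xi>)\<^sup>2) * h ((norm \<xi>)\<^sup>2)))"
  using h
proof (induction rule: gaussian_mixture.induct)
  case (gaussian_mixture_base s)
  have s: "0 < d + s" using gaussian_mixture_base d by simp
  have e: "exp (- d * (norm \<xi>)\<^sup>2) * exp (- s * (norm \<xi>)\<^sup>2) = exp (- (d + s) * (norm \<xi>)\<^sup>2)" for \<xi> :: 'a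
    by (simp add: algebra_simps flip: exp_add)
  have "(norm x)\<^sup>2 \<le> (norm y)\<^sup>2" using xy by (simp add: power_mono)
  then show ?case
    unfolding e using gaussian_cos[OF s, of x] gaussian_cos[OF s, of y] s
    by (simp add: has_bochner_integral_iff divide_right_mono mult_left_mono)
next
  case (gaussian_mixture_add f g)
  then show ?case
    using gaussian_mixture_integrable[OF gaussian_mixture_add.hyps(1) d, of x] gaussian_mixture_integrable[OF gaussian_mixture_add.hyps(2) d, of x]
      gaussian_mixture_integrable[OF gaussian_mixture_add.hyps(1) d, of y] gaussian_mixture_integrable[OF gaussian_mixture_add.hyps(2) d, of y]
    by (simp add: distrib_left Bochner_Integration.integral_add add_mono)
next
  case (gaussian_mixture_scale c f)
  have e: "cos (\<xi> \<bullet> x) * (exp (- d * (norm \<xi>)\<^sup>2) * (c * f ((norm \<xi>)\<^sup>2)))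
     = c * (cos (\<xi> \<bullet> x) * (exp (- d * (norm \<xi>)\<^sup>2) * f ((norm \<xi>)\<^sup>2)))" for x \<xi> :: 'a
    by simp
  show ?case unfolding e using gaussian_mixture_scale by (auto intro: mult_left_mono)
next
  case (gaussian_mixture_lim f g B)
  have lim: "(\<lambda>n. LINT \<xi>|lborel. cos (\<xi> \<bullet> x) * (exp (- d * (norm \<xi>)\<^sup>2) * f n ((norm \<xi>)\<^sup>2)))
      \<longlonglongrightarrow> (LINT \<xi>|lborel. cos (\<xi> \<bullet> x) * (exp (- d * (norm \<xi>)\<^sup>2) * g ((norm \<xi>)\<^sup>2)))" for x :: 'a
  proof (rule integral_dominated_convergence)
    have [measurable]: "f n \<in> borel_measurable borel" "g \<in> borel_measurable borel" for n
      using gaussian_mixture_measurable gaussian_mixture_lim by auto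
    show "(\<lambda>\<xi>. cos (\<xi> \<bullet> x) * (exp (- d * (norm \<xi>)\<^sup>2) * g ((norm \<xi>)\<^sup>2))) \<in> borel_measurable lborel"
      "(\<lambda>\<xi>. cos (\<xi> \<bullet> x) * (exp (- d * (norm \<xi>)\<^sup>2) * f n ((norm \<xi>)\<^sup>2))) \<in> borel_measurable lborel" for n
      by measurable
    show "integrable lborel (\<lambda>\<xi>::'a. B * exp (- d * (norm \<xi>)\<^sup>2))"
      using integrable_gaussian[OF d, where 'a='a] by simp
    show "AE \<xi> in lborel. (\<lambda>n. cos (\<xi> \<bullet> x) * (exp (- d * (norm \<xi>)\<^sup>2) * f n ((norm \<xi>)\<^sup>2)))
         \<longlonglongrightarrow> cos (\<xi> \<bullet> x) * (exp (- d * (norm \<xi>)\<^sup>2) * g ((norm \<xi>)\<^sup>2))"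
      using AE_lborel_singleton[of "0::'a"] by eventually_elim (use gaussian_mixture_lim in \<open>auto intro!: tendsto_intros\<close>)
    have "norm (cos (\<xi> \<bullet> x) * (exp (- d * (norm \<xi>)\<^sup>2) * f n ((norm \<xi>)\<^sup>2))) \<le> B * exp (- d * (norm \<xi>)\<^sup>2)"
      if "\<xi> \<noteq> 0" for \<xi> :: 'a and n
    proof -
      have *: "0 \<le> f n ((norm \<xi>)\<^sup>2)" "f n ((norm \<xi>)\<^sup>2) \<le> B" using that gaussian_mixture_lim gaussian_mixture_nonneg[OF gaussian_mixture_lim.hyps(1)] by auto
      then have "\<bar>cos (\<xi> \<bullet> x)\<bar> * (exp (- d * (norm \<xi>)\<^sup>2) * f n ((norm \<xi>)\<^sup>2)) \<le> 1 * (exp (- d * (norm \<xi>)\<^sup>2) * B)"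
        by (intro mult_mono) auto
      then show ?thesis using * by (simp add: abs_mult mult.commute)
    qed
    then show "AE \<xi> in lborel. norm (cos (\<xi> \<bullet> x) * (exp (- d * (norm \<xi>)\<^sup>2) * f n ((norm \<xi>)\<^sup>2))) \<le> B * exp (- d * (norm \<xi>)\<^sup>2)" for n
      using AE_lborel_singleton[of "0::'a"] by (auto elim!: eventually_mono)
  qed
  show ?case by (rule LIMSEQ_le[OF lim lim]) (use gaussian_mixture_lim in auto)
qed

section \<open>Gaussians as an approximate identity\<close>

lemma distr_lborel_reflect: "distr lborel borel (\<lambda>y. x - y) = (lborel :: 'a::euclidean_space measure)"
  using lborel_affine[of "-1" x] by (simp add: density_1)

lemma nn_integral_lborel_reflect:
  fixes f :: "'a::euclidean_space \<Rightarrow> ennreal"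
  assumes [measurable]: "f \<in> borel_measurable borel"
  shows "(\<integral>\<^sup>+y. f (x - y) \<partial>lborel) = (\<integral>\<^sup>+y. f y \<partial>lborel)"
  by (subst (2) distr_lborel_reflect[of x, symmetric]) (simp add: nn_integral_distr)

lemma has_integral_gauss_reflect:
  assumes s: "0 < s"
  shows "has_bochner_integral lborel (\<lambda>y. gauss s (x - y :: 'a::euclidean_space)) 1"
proof -
  have "has_bochner_integral (distr lborel borel (\<lambda>y. x - y)) (gauss s :: 'a \<Rightarrow> real) 1"
    unfolding distr_lborel_reflect by (rule has_integral_gauss[OF s])
  then show ?thesis
    by (simp add: has_bochner_integral_iff integrable_distr_eq integral_distr)
qed

text \<open>Outside a ball of radius \<open>r\<close> the Gaussian is small in two senses: in
  supremum, and in mass. For the second, half of the exponent is given up to produce the smallness,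
  and the other half forms a Gaussian of doubled variance. For fixed r > 0 both prefactors tend to 0
  with \<open>s\<close>.\<close>

lemma gauss_tail_bound:
  fixes z :: "'a::euclidean_space"
  assumes "0 < s" "0 \<le> r" "r \<le> norm z"
  shows "gauss s z \<le> (4 * pi * s) powr (- real DIM('a) / 2) * exp (- r\<^sup>2 / (4 * s))"
    and "gauss s z \<le> 2 powr (real DIM('a) / 2) * exp (- r\<^sup>2 / (8 * s)) * gauss (2 * s) z"
proof -
  have r: "r\<^sup>2 \<le> (norm z)\<^sup>2" using assms by (simp add: power_mono)
  show "gauss s z \<le> (4 * pi * s) powr (- real DIM('a) / 2) * exp (- r\<^sup>2 / (4 * s))"
    unfolding gauss_def using r assms by (intro mult_left_mono) (auto simp: divide_right_mono)
  have "(4 * pi * (2 * s)) powr (- real DIM('a) / 2) = (2 * (4 * pi * s)) powr (- real DIM('a) / 2)"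
    by (simp add: mult_ac)
  also have "\<dots> = 2 powr (- real DIM('a) / 2) * (4 * pi * s) powr (- real DIM('a) / 2)"
    using assms by (subst powr_mult) auto
  finally have e1: "2 powr (real DIM('a) / 2) * (4 * pi * (2 * s)) powr (- real DIM('a) / 2)
      = (2 powr (real DIM('a) / 2) * 2 powr (- real DIM('a) / 2)) * (4 * pi * s) powr (- real DIM('a) / 2)"
    by (simp only: mult.assoc)
  have e2: "(2::real) powr (real DIM('a) / 2) * 2 powr (- real DIM('a) / 2) = 1"
    by (simp add: powr_add[symmetric])
  have "- (norm z)\<^sup>2 / (4 * s) \<le> - r\<^sup>2 / (8 * s) + - (norm z)\<^sup>2 / (4 * (2 * s))"
    using r assms by (simp add: field_simps)
  then have e3: "exp (- (norm z)\<^sup>2 / (4 * s)) \<le> exp (- r\<^sup>2 / (8 * s)) * exp (- (norm z)\<^sup>2 / (4 * (2 * s)))"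
    by (simp only: exp_add[symmetric] exp_le_cancel_iff)
  have "gauss s z \<le> (4 * pi * s) powr (- real DIM('a) / 2) * (exp (- r\<^sup>2 / (8 * s)) * exp (- (norm z)\<^sup>2 / (4 * (2 * s))))"
    unfolding gauss_def by (intro mult_left_mono e3) auto
  also have "\<dots> = (2 powr (real DIM('a) / 2) * (4 * pi * (2 * s)) powr (- real DIM('a) / 2)) * (exp (- r\<^sup>2 / (8 * s)) * exp (- (norm z)\<^sup>2 / (4 * (2 * s))))"
    unfolding e1 e2 by simp
  also have "\<dots> = 2 powr (real DIM('a) / 2) * exp (- r\<^sup>2 / (8 * s)) * gauss (2 * s) z"
    by (simp add: gauss_def)
  finally show "gauss s z \<le> 2 powr (real DIM('a) / 2) * exp (- r\<^sup>2 / (8 * s)) * gauss (2 * s) z" .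
qed

lemma integrable_mult_gauss:
  fixes h :: "'a::euclidean_space \<Rightarrow> real"
  assumes h: "integrable lborel h" and s: "0 < s"
  shows "integrable lborel (\<lambda>y. h y * gauss s (x - y))"
proof (rule Bochner_Integration.integrable_bound)
  have [measurable]: "h \<in> borel_measurable borel" using borel_measurable_integrable[OF h] by simp
  show "integrable lborel (\<lambda>y. (4 * pi * s) powr (- real DIM('a) / 2) * h y)"
    using h by simp
  show "(\<lambda>y. h y * gauss s (x - y)) \<in> borel_measurable lborel" by measurable
  have "norm (h y * gauss s (x - y)) \<le> norm ((4 * pi * s) powr (- real DIM('a) / 2) * h y)" for y
  proof -
    have "\<bar>h y\<bar> * gauss s (x - y) \<le> \<bar>h y\<bar> * (4 * pi * s) powr (- real DIM('a) / 2)"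
      using gauss_tail_bound(1)[OF s, of 0 "x - y"] by (intro mult_left_mono) auto
    then show ?thesis by (simp add: abs_mult mult_ac)
  qed
  then show "AE y in lborel. norm (h y * gauss s (x - y)) \<le> norm ((4 * pi * s) powr (- real DIM('a) / 2) * h y)"
    by simp
qed

text \<open>Near \<open>x\<close> continuity controls h y - h x. Far from \<open>x\<close>, where
  \<open>h\<close> may be unbounded, the integrable |h y| is paired with the supremum of the
  Gaussian and the constant |h x| with its tail mass.\<close>

lemma gauss_approx_identity:
  fixes h :: "'a::euclidean_space \<Rightarrow> real"
  assumes h: "integrable lborel h" and c: "isCont h x"
  shows "(\<lambda>n. LINT y|lborel. h y * gauss (1 / real (Suc n)) (x - y)) \<longlonglongrightarrow> h x"
proof (rule tendstoI)
  fix e :: real assume e: "0 < e"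
  obtain r where r: "0 < r" "\<And>y. dist y x < r \<Longrightarrow> dist (h y) (h x) < e / 2"
    using c[unfolded continuous_at_eps_delta, rule_format, of "e / 2"] e by auto
  define N where "N = real DIM('a)"
  \<comment> \<open>\<open>A n\<close> and \<open>B n\<close> are the prefactors of the two bounds
    in \<open>gauss_tail_bound\<close> for s = 1 / (n + 1).\<close>
  define A where "A n = (4 * pi * (1 / real (Suc n))) powr (- N / 2) * exp (- r\<^sup>2 / (4 * (1 / real (Suc n))))" for n
  define B where "B n = 2 powr (N / 2) * exp (- r\<^sup>2 / (8 * (1 / real (Suc n))))" for n
  define L where "L = (LINT y|lborel. \<bar>h y\<bar>)"
  have r2: "0 < r\<^sup>2" using r by simp
  have N: "0 < N" by (simp add: N_def)
  have "A \<longlonglongrightarrow> 0" unfolding A_def using r2 N by real_asymp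
  moreover have "B \<longlonglongrightarrow> 0" unfolding B_def using r2 N by real_asymp
  ultimately have "(\<lambda>n. A n * L + \<bar>h x\<bar> * B n) \<longlonglongrightarrow> 0 * L + \<bar>h x\<bar> * 0"
    by (intro tendsto_intros)
  then have "\<forall>\<^sub>F n in sequentially. A n * L + \<bar>h x\<bar> * B n < e / 2"
    using e by (intro order_tendstoD(2)) auto
  then show "\<forall>\<^sub>F n in sequentially. dist (LINT y|lborel. h y * gauss (1 / real (Suc n)) (x - y)) (h x) < e"
  proof eventually_elim
    case (elim n)
    define s where "s = 1 / real (Suc n)"
    have s: "0 < s" by (simp add: s_def)
    have g: "integrable lborel (\<lambda>y. gauss s (x - y))" "(LINT y|lborel. gauss s (x - y)) = 1"
      using has_integral_gauss_reflect[OF s, of x] by (auto simp: has_bochner_integral_iff)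
    have g2: "integrable lborel (\<lambda>y. gauss (2 * s) (x - y))" "(LINT y|lborel. gauss (2 * s) (x - y)) = 1"
      using has_integral_gauss_reflect[of "2 * s" x] s by (auto simp: has_bochner_integral_iff)
    have hg: "integrable lborel (\<lambda>y. h y * gauss s (x - y))"
      by (rule integrable_mult_gauss[OF h s])
    have bd: "\<bar>(h y - h x) * gauss s (x - y)\<bar> \<le> e / 2 * gauss s (x - y) + (A n * \<bar>h y\<bar> + \<bar>h x\<bar> * B n * gauss (2 * s) (x - y))" for y
    proof (cases "dist y x < r")
      case True
      have "\<bar>h y - h x\<bar> \<le> e / 2"
        using r(2)[OF True] by (simp add: dist_real_def)
      then have "\<bar>(h y - h x) * gauss s (x - y)\<bar> \<le> e / 2 * gauss s (x - y)"
        unfolding abs_mult abs_of_nonneg[OF gauss_nonneg] by (rule mult_right_mono) simp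
      moreover have "0 \<le> A n * \<bar>h y\<bar> + \<bar>h x\<bar> * B n * gauss (2 * s) (x - y)"
        by (simp add: A_def B_def)
      ultimately show ?thesis by linarith
    next
      case False
      then have nr: "r \<le> norm (x - y)" by (simp add: dist_norm norm_minus_commute)
      have "\<bar>(h y - h x) * gauss s (x - y)\<bar> \<le> \<bar>h y\<bar> * gauss s (x - y) + \<bar>h x\<bar> * gauss s (x - y)"
        by (simp add: abs_mult distrib_right[symmetric] mult_right_mono)
      also have "\<dots> \<le> \<bar>h y\<bar> * A n + \<bar>h x\<bar> * (B n * gauss (2 * s) (x - y))"
        using gauss_tail_bound[OF s _ nr] r(1)
        by (intro add_mono mult_left_mono) (auto simp: A_def B_def N_def s_def)
      also have "\<dots> = A n * \<bar>h y\<bar> + \<bar>h x\<bar> * B n * gauss (2 * s) (x - y)" by simp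
      finally show ?thesis using e gauss_nonneg[of s "x - y"] by (smt (verit) half_gt_zero mult_nonneg_nonneg)
    qed
    have "(LINT y|lborel. h y * gauss s (x - y)) - h x = (LINT y|lborel. h y * gauss s (x - y)) - (LINT y|lborel. h x * gauss s (x - y))"
      using g by simp
    also have "\<dots> = (LINT y|lborel. (h y - h x) * gauss s (x - y))"
      unfolding left_diff_distrib using hg g(1) by (intro Bochner_Integration.integral_diff[symmetric]) auto
    finally have "\<bar>(LINT y|lborel. h y * gauss s (x - y)) - h x\<bar> \<le> (LINT y|lborel. \<bar>(h y - h x) * gauss s (x - y)\<bar>)"
      using integral_abs_bound by metis
    also have "\<dots> \<le> (LINT y|lborel. e / 2 * gauss s (x - y) + (A n * \<bar>h y\<bar> + \<bar>h x\<bar> * B n * gauss (2 * s) (x - y)))"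
    proof (rule integral_mono)
      show "integrable lborel (\<lambda>y. \<bar>(h y - h x) * gauss s (x - y)\<bar>)"
        unfolding left_diff_distrib using hg g(1) by auto
      show "integrable lborel (\<lambda>y. e / 2 * gauss s (x - y) + (A n * \<bar>h y\<bar> + \<bar>h x\<bar> * B n * gauss (2 * s) (x - y)))"
        using h g(1) g2(1) by auto
    qed (rule bd)
    also have "\<dots> = e / 2 * 1 + (A n * L + \<bar>h x\<bar> * B n * 1)"
      unfolding L_def using h g g2 by (simp add: Bochner_Integration.integral_add)
    finally have "\<bar>(LINT y|lborel. h y * gauss s (x - y)) - h x\<bar> < e"
      using elim by simp
    then show ?case by (simp add: dist_real_def s_def)
  qed
qed

text \<open>The integrand is dominated by |f x| |g y|. With a cosine as \<open>c\<close>, this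
  exchanges a convolution in space for a transform in frequency.\<close>

lemma fubini_bounded_kernel:
  fixes f :: "'a::euclidean_space \<Rightarrow> real" and g :: "'b::euclidean_space \<Rightarrow> real"
  assumes f: "integrable lborel f" and g: "integrable lborel g"
    and c[measurable]: "(\<lambda>(x, y). c x y) \<in> borel_measurable (borel \<Otimes>\<^sub>M borel)"
    and c1: "\<And>x y. \<bar>c x y\<bar> \<le> 1"
  shows "(LINT x|lborel. f x * (LINT y|lborel. c x y * g y)) = (LINT y|lborel. g y * (LINT x|lborel. c x y * f x))"
proof -
  have [measurable]: "f \<in> borel_measurable borel" "g \<in> borel_measurable borel"
    using borel_measurable_integrable[OF f] borel_measurable_integrable[OF g] by auto
  have m[measurable]: "(\<lambda>(x, y). c x y) \<in> borel_measurable (lborel \<Otimes>\<^sub>M lborel)"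
    using c by (simp cong: measurable_cong_sets sets_pair_measure_cong)
  let ?F = "\<lambda>(x, y). f x * (c x y * g y)"
  have meas: "?F \<in> borel_measurable (lborel \<Otimes>\<^sub>M lborel)" by measurable
  have cx[measurable]: "(\<lambda>y. c x y) \<in> borel_measurable borel" for x
    using measurable_compose[OF measurable_Pair1' c, of x] by simp
  have cgi: "integrable lborel (\<lambda>y. c x y * g y)" for x
  proof (rule Bochner_Integration.integrable_bound[OF g])
    show "AE y in lborel. norm (c x y * g y) \<le> norm (g y)"
      using mult_right_mono[OF c1 abs_ge_zero] by (simp add: abs_mult)
  qed measurable
  have "integrable (lborel \<Otimes>\<^sub>M lborel) ?F"
  proof (rule lborel_pair.Fubini_integrable[OF meas])
    show "AE x in lborel. integrable lborel (\<lambda>y. ?F (x, y))" using cgi by simp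
    show "integrable lborel (\<lambda>x. LINT y|lborel. norm (?F (x, y)))"
    proof (rule Bochner_Integration.integrable_bound)
      show "integrable lborel (\<lambda>x. f x * (LINT y|lborel. \<bar>g y\<bar>))" using f by simp
      show "(\<lambda>x. LINT y|lborel. norm (?F (x, y))) \<in> borel_measurable lborel"
        using meas by measurable
      have "(LINT y|lborel. \<bar>c x y * g y\<bar>) \<le> (LINT y|lborel. \<bar>g y\<bar>)" for x
        by (intro integral_mono integrable_abs cgi g) (use mult_right_mono[OF c1 abs_ge_zero] in \<open>simp add: abs_mult\<close>)
      then have "\<bar>f x\<bar> * (LINT y|lborel. \<bar>c x y * g y\<bar>) \<le> \<bar>f x\<bar> * (LINT y|lborel. \<bar>g y\<bar>)" for x
        by (intro mult_left_mono) auto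
      then show "AE x in lborel. norm (LINT y|lborel. norm (?F (x, y))) \<le> norm (f x * (LINT y|lborel. \<bar>g y\<bar>))"
        by (simp add: abs_mult)
    qed
  qed
  then have "integrable (lborel \<Otimes>\<^sub>M lborel) (case_prod (\<lambda>x y. f x * (c x y * g y)))" by simp
  from lborel_pair.Fubini_integral[OF this]
  have "(LINT y|lborel. LINT x|lborel. f x * (c x y * g y)) = (LINT x|lborel. LINT y|lborel. f x * (c x y * g y))" .
  moreover have "(LINT x|lborel. f x * (c x y * g y)) = g y * (LINT x|lborel. c x y * f x)" for y
    by (subst integral_mult_right_zero[symmetric]) (simp add: mult_ac)
  ultimately show ?thesis by simp
qed

section \<open>The fundamental solution\<close>

locale fractional_heat_kernel =
  fixes \<theta> :: real and G :: "(real ^ 'n) \<times> real \<Rightarrow> real"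
  assumes \<theta>: "0 < \<theta>" "\<theta> \<le> 2" and fundamental: "fundamental_solution \<theta> G"
begin

lemma pos: "0 < t \<Longrightarrow> 0 < G (x, t)"
  using fundamental by (auto simp: fundamental_solution_def)

lemma nonneg: "0 < t \<Longrightarrow> 0 \<le> G (x, t)"
  using pos by (simp add: less_imp_le)

lemma continuous: "continuous_on (UNIV \<times> {0<..}) G"
proof -
  have "Ck_on 0 (strip \<infinity>) G"
    using fundamental unfolding fundamental_solution_def smooth_on_def by blast
  moreover have "strip \<infinity> = (UNIV \<times> {0<..} :: ((real ^ 'n) \<times> real) set)"
    by (auto simp: strip_def)
  ultimately show ?thesis by simp
qed

lemma continuous_slice: "0 < t \<Longrightarrow> continuous_on UNIV (\<lambda>x. G (x, t))"
  by (rule continuous_on_compose2[OF continuous]) (auto intro!: continuous_intros)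

lemma measurable_slice [measurable]: "0 < t \<Longrightarrow> (\<lambda>x. G (x, t)) \<in> borel_measurable borel"
  by (rule borel_measurable_continuous_onI[OF continuous_slice])

lemma integrable_slice: "0 < t \<Longrightarrow> integrable lborel (\<lambda>x. G (x, t))"
  using fundamental integrable_completion[of "\<lambda>x. G (x, t)" lborel] by (auto simp: fundamental_solution_def)

section \<open>Fourier inversion, radial monotonicity and the semigroup property\<close>

lemma fourier:
  assumes t: "0 < t"
  shows "(LINT x|lborel. G (x, t) * cos (\<xi> \<bullet> x)) = exp (- t * norm \<xi> powr \<theta>)"
    and "(LINT x|lborel. G (x, t) * sin (\<xi> \<bullet> x)) = 0"
proof -
  let ?f = "\<lambda>x. complex_of_real (G (x, t)) * exp (- \<i> * complex_of_real (\<xi> \<bullet> x))"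
  have [measurable]: "(\<lambda>x. G (x, t)) \<in> borel_measurable borel" by (rule measurable_slice[OF t])
  have m: "?f \<in> borel_measurable lborel" by measurable
  have "integrable lborel ?f"
  proof (rule Bochner_Integration.integrable_bound[OF integrable_slice[OF t]])
    show "AE x in lborel. norm (?f x) \<le> norm (G (x, t))" by (simp add: norm_mult)
  qed (rule m)
  moreover have "(LINT x|lborel. ?f x) = complex_of_real (exp (- t * norm \<xi> powr \<theta>))"
    using fundamental t integral_completion[OF m] by (auto simp: fundamental_solution_def)
  ultimately have hb: "has_bochner_integral lborel ?f (complex_of_real (exp (- t * norm \<xi> powr \<theta>)))"
    by (simp add: has_bochner_integral_iff)
  have "Re (?f x) = G (x, t) * cos (\<xi> \<bullet> x)" "Im (?f x) = - (G (x, t) * sin (\<xi> \<bullet> x))" for x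
    by (simp_all add: Re_exp Im_exp )
  then have eqs: "(\<lambda>x. Re (?f x)) = (\<lambda>x. G (x, t) * cos (\<xi> \<bullet> x))"
      "(\<lambda>x. Im (?f x)) = (\<lambda>x. - (G (x, t) * sin (\<xi> \<bullet> x)))"
    by auto
  show "(LINT x|lborel. G (x, t) * cos (\<xi> \<bullet> x)) = exp (- t * norm \<xi> powr \<theta>)"
    and "(LINT x|lborel. G (x, t) * sin (\<xi> \<bullet> x)) = 0"
    using has_bochner_integral_bounded_linear[OF bounded_linear_Re hb, unfolded eqs]
      has_bochner_integral_bounded_linear[OF bounded_linear_Im hb, unfolded eqs]
    by (simp_all add: has_bochner_integral_iff)
qed

lemma integral_slice: "0 < t \<Longrightarrow> (LINT x|lborel. G (x, t)) = 1"
  using fourier(1)[of t 0] by simp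

text \<open>In the addition formula for the cosine only one term survives, since the sine transform
  of \<open>G\<close> vanishes.\<close>

lemma fourier_shift:
  assumes t: "0 < t"
  shows "(LINT y|lborel. cos (\<xi> \<bullet> (x - y)) * G (y, t)) = cos (\<xi> \<bullet> x) * exp (- t * norm \<xi> powr \<theta>)"
proof -
  have [measurable]: "(\<lambda>x. G (x, t)) \<in> borel_measurable borel" by (rule measurable_slice[OF t])
  have i: "integrable lborel (\<lambda>y. G (y, t) * cos (\<xi> \<bullet> y))" "integrable lborel (\<lambda>y. G (y, t) * sin (\<xi> \<bullet> y))"
    by (rule Bochner_Integration.integrable_bound[OF integrable_slice[OF t]];
        (measurable; fail | simp add: abs_mult mult_left_le))+
  have "cos (\<xi> \<bullet> (x - y)) * G (y, t) = cos (\<xi> \<bullet> x) * (G (y, t) * cos (\<xi> \<bullet> y)) + sin (\<xi> \<bullet> x) * (G (y, t) * sin (\<xi> \<bullet> y))" for y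
    by (simp add: inner_diff_right cos_diff algebra_simps)
  then show ?thesis
    using i fourier[OF t, of \<xi>] by (simp add: Bochner_Integration.integral_add)
qed

text \<open>Convolution with \<open>G\<close> multiplies by its symbol on the Fourier side. Cosine
  transforms keep the argument within the reals.\<close>

lemma convolution_cos:
  assumes t: "0 < t" and q: "integrable lborel q"
  shows "(LINT y|lborel. G (y, t) * (LINT \<xi>|lborel. cos (\<xi> \<bullet> (x - y)) * q \<xi>))
       = (LINT \<xi>|lborel. cos (\<xi> \<bullet> x) * (q \<xi> * exp (- t * norm \<xi> powr \<theta>)))"
proof -
  have "(LINT y|lborel. G (y, t) * (LINT \<xi>|lborel. cos (\<xi> \<bullet> (x - y)) * q \<xi>))
      = (LINT \<xi>|lborel. q \<xi> * (LINT y|lborel. cos (\<xi> \<bullet> (x - y)) * G (y, t)))"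
    by (rule fubini_bounded_kernel[OF integrable_slice[OF t] q]) (auto simp: abs_cos_le_one)
  then show ?thesis by (simp only: fourier_shift[OF t] mult.left_commute)
qed

lemma convolution_gauss:
  assumes t: "0 < t" and d: "0 < d"
  shows "(LINT y|lborel. G (y, t) * gauss d (x - y))
    = (LINT \<xi>|lborel. cos (\<xi> \<bullet> x) * (exp (- d * (norm \<xi>)\<^sup>2) * exp (- t * norm \<xi> powr \<theta>))) / (2 * pi) ^ CARD('n)"
  unfolding gauss_eq_cos[OF d] convolution_cos[OF t integrable_gaussian[OF d], symmetric] by simp

text \<open>A form of Fourier inversion available before the symbol is known to be integrable: the
  Gaussian factor makes the integrals converge, and \<open>G\<close> is recovered from its
  mollifications by continuity.\<close>

lemma gauss_regularisation_tendsto: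
  assumes t: "0 < t"
  shows "(\<lambda>n. (LINT \<xi>|lborel. cos (\<xi> \<bullet> x) * (exp (- (1 / real (Suc n)) * (norm \<xi>)\<^sup>2) * exp (- t * norm \<xi> powr \<theta>))))
    \<longlonglongrightarrow> (2 * pi) ^ CARD('n) * G (x, t)"
proof -
  have "isCont (\<lambda>x. G (x, t)) x"
    using continuous_slice[OF t] by (simp add: continuous_on_eq_continuous_at)
  then have "(\<lambda>n. (2 * pi) ^ CARD('n) * (LINT y|lborel. G (y, t) * gauss (1 / real (Suc n)) (x - y))) \<longlonglongrightarrow> (2 * pi) ^ CARD('n) * G (x, t)"
    by (intro tendsto_mult tendsto_const gauss_approx_identity integrable_slice t)
  then show ?thesis by (simp add: convolution_gauss[OF t])
qed

text \<open>Writes the symbol as a function of |\<xi>|^2 with exponent \<theta>/2 in (0,1], the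
  range covered by \<open>gaussian_mixture_stable\<close>.\<close>

lemma norm_powr_square: "norm \<xi> powr \<theta> = ((norm \<xi>)\<^sup>2) powr (\<theta> / 2)"
  for \<xi> :: "real ^ 'n"
  by (cases "\<xi> = 0") (simp_all add: powr_powr flip: powr_numeral)

text \<open>Each regularised inversion integral decreases with the norm by
  \<open>gaussian_mixture_cos_antimono\<close>, and the inequality passes to the limit.\<close>

lemma radially_decreasing:
  assumes t: "0 < t" and xy: "norm x \<le> norm y"
  shows "G (y, t) \<le> G (x, t)"
proof -
  have h: "gaussian_mixture (\<lambda>u. exp (- t * u powr (\<theta> / 2)))"
    using \<theta> t by (intro gaussian_mixture_stable) auto
  have "(2 * pi) ^ CARD('n) * G (y, t) \<le> (2 * pi) ^ CARD('n) * G (x, t)"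
  proof (rule LIMSEQ_le[OF gauss_regularisation_tendsto[OF t] gauss_regularisation_tendsto[OF t]], intro exI allI impI)
    fix n :: nat
    show "(LINT \<xi>|lborel. cos (\<xi> \<bullet> y) * (exp (- (1 / real (Suc n)) * (norm \<xi>)\<^sup>2) * exp (- t * norm \<xi> powr \<theta>)))
        \<le> (LINT \<xi>|lborel. cos (\<xi> \<bullet> x) * (exp (- (1 / real (Suc n)) * (norm \<xi>)\<^sup>2) * exp (- t * norm \<xi> powr \<theta>)))"
      unfolding norm_powr_square by (rule gaussian_mixture_cos_antimono[OF h _ xy]) simp
  qed
  then show ?thesis by simp
qed

text \<open>Monotone convergence in the Gaussian regularisation makes the symbol integrable without any
  direct estimate.\<close>

lemma has_integral_symbol:
  assumes t: "0 < t"
  shows "has_bochner_integral lborel (\<lambda>\<xi>::real ^ 'n. exp (- t * norm \<xi> powr \<theta>)) ((2 * pi) ^ CARD('n) * G (0, t))"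
proof (rule has_bochner_integral_monotone_convergence)
  let ?f = "\<lambda>n (\<xi> :: real ^ 'n). exp (- (1 / real (Suc n)) * (norm \<xi>)\<^sup>2) * exp (- t * norm \<xi> powr \<theta>)"
  have h: "gaussian_mixture (\<lambda>u. exp (- t * u powr (\<theta> / 2)))"
    using \<theta> t by (intro gaussian_mixture_stable) auto
  show "integrable lborel (?f n)" for n
    using gaussian_mixture_integrable[OF h, of "1 / real (Suc n)" 0] by (simp add: norm_powr_square)
  have "mono (\<lambda>n. ?f n \<xi>)" for \<xi>
    by (auto intro!: monoI mult_right_mono divide_left_mono)
  then show "AE \<xi> in lborel. mono (\<lambda>n. ?f n \<xi>)" by (intro AE_I2)
  show "AE \<xi> in lborel. (\<lambda>n. ?f n \<xi>) \<longlonglongrightarrow> exp (- t * norm \<xi> powr \<theta>)"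
  proof (rule AE_I2)
    fix \<xi> :: "real ^ 'n"
    have "(\<lambda>n. exp (- (1 / real (Suc n)) * (norm \<xi>)\<^sup>2)) \<longlonglongrightarrow> 1"
      by real_asymp
    from tendsto_mult[OF this tendsto_const]
    show "(\<lambda>n. ?f n \<xi>) \<longlonglongrightarrow> exp (- t * norm \<xi> powr \<theta>)" by simp
  qed
  \<comment> \<open>At the origin the cosine is 1, so the regularised inversion formula gives a
    finite limit for the integrals of the increasing approximants.\<close>
  show "(\<lambda>n. integral\<^sup>L lborel (?f n)) \<longlonglongrightarrow> (2 * pi) ^ CARD('n) * G (0, t)"
    using gauss_regularisation_tendsto[OF t, of 0] by simp
  show "(\<lambda>\<xi>::real ^ 'n. exp (- t * norm \<xi> powr \<theta>)) \<in> borel_measurable lborel"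
    by measurable
qed

text \<open>The symbol, now known to be integrable, dominates the regularised integrands, so the
  Gaussian factor can be removed.\<close>

lemma fourier_inversion:
  assumes t: "0 < t"
  shows "G (x, t) = (LINT \<xi>|lborel. cos (\<xi> \<bullet> x) * exp (- t * norm \<xi> powr \<theta>)) / (2 * pi) ^ CARD('n)"
proof -
  have "(\<lambda>n. (LINT \<xi>|lborel. cos (\<xi> \<bullet> x) * (exp (- (1 / real (Suc n)) * (norm \<xi>)\<^sup>2) * exp (- t * norm \<xi> powr \<theta>))))
    \<longlonglongrightarrow> (LINT \<xi>|lborel. cos (\<xi> \<bullet> x) * exp (- t * norm \<xi> powr \<theta>))"
  proof (rule integral_dominated_convergence)
    show "integrable lborel (\<lambda>\<xi>::real ^ 'n. exp (- t * norm \<xi> powr \<theta>))"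
      using has_integral_symbol[OF t] by (simp add: has_bochner_integral_iff)
    show "AE \<xi> in lborel. (\<lambda>n. cos (\<xi> \<bullet> x) * (exp (- (1 / real (Suc n)) * (norm \<xi>)\<^sup>2) * exp (- t * norm \<xi> powr \<theta>)))
        \<longlonglongrightarrow> cos (\<xi> \<bullet> x) * exp (- t * norm \<xi> powr \<theta>)"
    proof (rule AE_I2)
      fix \<xi> :: "real ^ 'n"
      have "(\<lambda>n. exp (- (1 / real (Suc n)) * (norm \<xi>)\<^sup>2)) \<longlonglongrightarrow> 1"
        by real_asymp
      from tendsto_mult[OF tendsto_const tendsto_mult[OF this tendsto_const]]
      show "(\<lambda>n. cos (\<xi> \<bullet> x) * (exp (- (1 / real (Suc n)) * (norm \<xi>)\<^sup>2) * exp (- t * norm \<xi> powr \<theta>)))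
        \<longlonglongrightarrow> cos (\<xi> \<bullet> x) * exp (- t * norm \<xi> powr \<theta>)" by simp
    qed
    have "\<bar>cos (\<xi> \<bullet> x)\<bar> * (exp (- (1 / real (Suc n)) * (norm \<xi>)\<^sup>2) * exp (- t * norm \<xi> powr \<theta>)) \<le> 1 * (1 * exp (- t * norm \<xi> powr \<theta>))"
      for n and \<xi> :: "real ^ 'n"
      by (intro mult_mono) auto
    then show "AE \<xi> in lborel. norm (cos (\<xi> \<bullet> x) * (exp (- (1 / real (Suc n)) * (norm \<xi>)\<^sup>2) * exp (- t * norm \<xi> powr \<theta>)))
        \<le> exp (- t * norm \<xi> powr \<theta>)" for n
      by (simp add: abs_mult)
  qed measurable
  from LIMSEQ_unique[OF this gauss_regularisation_tendsto[OF t]]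
  show ?thesis by simp
qed

text \<open>The symbols at times \<open>t\<close> and \<open>s\<close> multiply to the symbol at t +
  s. Inverting one of the two kernels brings the convolution into the form of
  \<open>convolution_cos\<close>.\<close>

lemma semigroup:
  assumes t: "0 < t" and s: "0 < s"
  shows "(LINT y|lborel. G (y, s) * G (x - y, t)) = G (x, t + s)"
proof -
  have q: "integrable lborel (\<lambda>\<xi>::real ^ 'n. exp (- t * norm \<xi> powr \<theta>))"
    using has_integral_symbol[OF t] by (simp add: has_bochner_integral_iff)
  have ts: "0 < t + s" using t s by simp
  have e: "exp (- t * norm \<xi> powr \<theta>) * exp (- s * norm \<xi> powr \<theta>) = exp (- (t + s) * norm \<xi> powr \<theta>)" for \<xi> :: "real ^ 'n"
    by (simp add: algebra_simps flip: exp_add)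
  have "(LINT y|lborel. G (y, s) * G (x - y, t))
      = (LINT y|lborel. G (y, s) * (LINT \<xi>|lborel. cos (\<xi> \<bullet> (x - y)) * exp (- t * norm \<xi> powr \<theta>))) / (2 * pi) ^ CARD('n)"
    by (simp add: fourier_inversion[OF t])
  then show ?thesis
    unfolding convolution_cos[OF s q] e fourier_inversion[OF ts] .
qed

lemma bounded_by_origin: "0 < t \<Longrightarrow> G (x, t) \<le> G (0, t)"
  by (rule radially_decreasing) auto

text \<open>The version with a base point \<open>z\<close>, obtained by translating y, is the one
  that appears after Tonelli in \<open>heat_heat\<close>.\<close>

lemma semigroup_nn:
  assumes t: "0 < t" and s: "0 < s"
  shows "(\<integral>\<^sup>+y. ennreal (G (x - y, t)) * ennreal (G (y - z, s)) \<partial>lborel) = ennreal (G (x - z, t + s))"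
proof -
  have [measurable]: "(\<lambda>x. G (x, t)) \<in> borel_measurable borel" "(\<lambda>x. G (x, s)) \<in> borel_measurable borel"
    using t s by auto
  have "integrable lborel (\<lambda>y. G (y, s) * G (x - z - y, t))"
  proof (rule Bochner_Integration.integrable_bound)
    show "integrable lborel (\<lambda>y. G (0, t) * G (y, s))" using integrable_slice[OF s] by simp
    have "norm (G (y, s) * G (x - z - y, t)) \<le> norm (G (0, t) * G (y, s))" for y
      using mult_left_mono[OF bounded_by_origin[OF t, of "x - z - y"] nonneg[OF s, of y]] nonneg[OF t] nonneg[OF s]
      by (simp add: abs_mult mult.commute[of "G (0, t)"])
    then show "AE y in lborel. norm (G (y, s) * G (x - z - y, t)) \<le> norm (G (0, t) * G (y, s))"
      by (intro AE_I2)
  qed measurable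
  then have "(\<integral>\<^sup>+y. ennreal (G (y, s) * G (x - z - y, t)) \<partial>lborel) = ennreal (G (x - z, t + s))"
    using nonneg[OF t] nonneg[OF s] by (subst nn_integral_eq_integral) (auto simp: semigroup[OF t s])
  moreover have "(\<integral>\<^sup>+y. ennreal (G (x - y, t)) * ennreal (G (y - z, s)) \<partial>lborel)
     = (\<integral>\<^sup>+y. ennreal (G (y, s) * G (x - z - y, t)) \<partial>lborel)"
  proof -
    have "(\<integral>\<^sup>+y. ennreal (G (y, s) * G (x - z - y, t)) \<partial>lborel)
        = (\<integral>\<^sup>+y. ennreal (G (y, s) * G (x - z - y, t)) \<partial>distr lborel borel (\<lambda>y. - z + y))"
      using lborel_affine[of 1 "- z"] by (simp add: density_1)
    also have "\<dots> = (\<integral>\<^sup>+y. ennreal (G (- z + y, s) * G (x - z - (- z + y), t)) \<partial>lborel)"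
      by (subst nn_integral_distr) auto
    also have "\<dots> = (\<integral>\<^sup>+y. ennreal (G (x - y, t)) * ennreal (G (y - z, s)) \<partial>lborel)"
      using nonneg[OF t] nonneg[OF s] by (simp add: ennreal_mult mult.commute)
    finally show ?thesis by simp
  qed
  ultimately show ?thesis by simp
qed

lemma total_mass:
  assumes t: "0 < t"
  shows "(\<integral>\<^sup>+y. ennreal (G (x - y, t)) \<partial>lborel) = 1"
proof -
  have [measurable]: "(\<lambda>x. G (x, t)) \<in> borel_measurable borel" using t by auto
  have "(\<integral>\<^sup>+y. ennreal (G (x - y, t)) \<partial>lborel) = (\<integral>\<^sup>+y. ennreal (G (y, t)) \<partial>lborel)"
    by (rule nn_integral_lborel_reflect) measurable
  also have "\<dots> = 1"
    using nonneg[OF t] integrable_slice[OF t] by (subst nn_integral_eq_integral) (auto simp: integral_slice[OF t])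
  finally show ?thesis .
qed

text \<open>Follows from inversion at the origin by a dilation of the frequency. Consequently
  \<open>G (0, t)\<close> times the volume of a ball of radius t^(1/\<theta>) does not depend on
  \<open>t\<close>.\<close>

lemma origin_scaling:
  assumes t: "0 < t"
  shows "G (0, t) = t powr (- real CARD('n) / \<theta>) * G (0, 1)"
proof -
  \<comment> \<open>Since c^\<theta> = 1/t, replacing \<xi> by c \<xi> turns the symbol at time
    \<open>t\<close> into the symbol at time 1.\<close>
  define c where "c = t powr (- 1 / \<theta>)"
  have c: "0 < c" using t by (simp add: c_def)
  have "c powr \<theta> = 1 / t"
    using t \<theta> unfolding c_def powr_powr by (simp add: powr_minus_divide)
  then have e: "- t * norm (c *\<^sub>R \<xi>) powr \<theta> = - 1 * norm \<xi> powr \<theta>" for \<xi> :: "real ^ 'n"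
    using t c by (simp add: powr_mult)
  have cN: "c ^ CARD('n) = t powr (- real CARD('n) / \<theta>)"
    using t by (simp add: c_def powr_powr flip: powr_realpow)
  have "(2 * pi) ^ CARD('n) * G (0, t) = (LINT \<xi>|lborel. exp (- t * norm (\<xi> :: real ^ 'n) powr \<theta>))"
    using has_integral_symbol[OF t] by (simp add: has_bochner_integral_iff)
  also have "\<dots> = (LINT \<xi>|density (distr lborel borel (\<lambda>x. 0 + c *\<^sub>R x)) (\<lambda>_. ennreal (\<bar>c\<bar> ^ DIM(real ^ 'n))). exp (- t * norm (\<xi> :: real ^ 'n) powr \<theta>))"
    using c by (subst lborel_affine[of c 0]) (auto simp: ennreal_power)
  also have "\<dots> = c ^ CARD('n) * (LINT \<xi>|distr lborel borel (\<lambda>x. 0 + c *\<^sub>R x). exp (- t * norm (\<xi> :: real ^ 'n) powr \<theta>))"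
    using c by (subst integral_density) auto
  also have "\<dots> = c ^ CARD('n) * (LINT \<xi>|lborel. exp (- 1 * norm (\<xi> :: real ^ 'n) powr \<theta>))"
    by (subst integral_distr) (auto simp only: e add_0_left, measurable)
  also have "\<dots> = c ^ CARD('n) * ((2 * pi) ^ CARD('n) * G (0, 1))"
    using has_integral_symbol[of 1] by (simp add: has_bochner_integral_iff)
  finally show ?thesis unfolding cN by simp
qed

text \<open>The ball of radius \<open>r/2\<close> internally tangent to the sphere of radius \<open>|z|\<close> at \<open>z\<close> lies in
  \<open>ball z r\<close>, and \<open>G(\<cdot>,t)\<close> is at least \<open>G(z,t)\<close> on it.\<close>

lemma le_local_integral:
  assumes t: "0 < t" and r: "0 < r" "r / 2 \<le> norm z"
  shows "ennreal (unit_ball_vol (real CARD('n)) * (r / 2) ^ CARD('n)) * ennreal (G (z, t))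
       \<le> (\<integral>\<^sup>+w. indicator (ball z r) w * ennreal (G (w, t)) \<partial>lborel)"
proof -
  have [measurable]: "(\<lambda>x. G (x, t)) \<in> borel_measurable borel" using t by auto
  define c where "c = (1 - r / 2 / norm z) *\<^sub>R z"
  have z: "0 < norm z" using r by linarith
  then have nz: "norm c = norm z - r / 2"
    using r by (simp add: c_def abs_of_nonneg field_simps)
  have cz: "norm (z - c) = r / 2"
    using z r by (simp add: c_def algebra_simps)
  have sub: "w \<in> ball z r \<and> norm w \<le> norm z" if "w \<in> ball c (r / 2)" for w
  proof
    have d: "norm (c - w) < r / 2" using that by (simp add: dist_norm)
    show "norm w \<le> norm z" using norm_triangle_ineq4[of c "c - w"] d nz by simp
    show "w \<in> ball z r" using norm_triangle_ineq[of "z - c" "c - w"] d cz by (simp add: dist_norm)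
  qed
  have "ennreal (unit_ball_vol (real CARD('n)) * (r / 2) ^ CARD('n)) * ennreal (G (z, t))
      = (\<integral>\<^sup>+w. ennreal (G (z, t)) * indicator (ball c (r / 2)) w \<partial>lborel)"
    using r by (subst nn_integral_cmult_indicator) (auto simp: emeasure_ball mult.commute)
  also have "\<dots> \<le> (\<integral>\<^sup>+w. indicator (ball z r) w * ennreal (G (w, t)) \<partial>lborel)"
    by (intro nn_integral_mono)
      (use sub radially_decreasing[OF t] in \<open>auto simp: ennreal_leI split: split_indicator\<close>)
  finally show ?thesis .
qed

text \<open>With r = t^(1/\<theta>), the first summand is \<open>G (0, t)\<close> times the volume
  of a ball of radius r, and the second is the volume ratio of balls of radii r and r/2. They come
  from the near and the far part of the convolution in \<open>smoothing\<close>.\<close>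

definition smoothing_constant :: real where
  "smoothing_constant = unit_ball_vol (real CARD('n)) * G (0, 1) + 2 ^ CARD('n)"

lemma smoothing_constant_pos: "0 < smoothing_constant"
  using nonneg[of 1 0] unit_ball_vol_pos[of "real CARD('n)"]
  by (auto simp: smoothing_constant_def intro!: add_nonneg_pos mult_nonneg_nonneg)

text \<open>For |x - y| < r the kernel is at most \<open>G (0, t)\<close>. For larger distances
  \<open>le_local_integral\<close> replaces it by its integral over a ball, and Tonelli then moves
  the ball onto \<open>f\<close>: the far part becomes an average of ball integrals of
  \<open>f\<close> against the unit mass of \<open>G\<close>.\<close>

lemma smoothing:
  assumes t: "0 < t" and f[measurable]: "f \<in> borel_measurable borel" and M: "0 \<le> M"
    and le: "\<And>z. (\<integral>\<^sup>+y. indicator (ball z (t powr (1 / \<theta>))) y * f y \<partial>lborel)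
          \<le> ennreal M * emeasure lborel (ball z (t powr (1 / \<theta>)))"
  shows "(\<integral>\<^sup>+y. ennreal (G (x - y, t)) * f y \<partial>lborel) \<le> ennreal (smoothing_constant * M)"
proof -
  have [measurable]: "(\<lambda>x. G (x, t)) \<in> borel_measurable borel" using t by auto
  define r where "r = t powr (1 / \<theta>)"
  define v where "v = unit_ball_vol (real CARD('n))"
  define U where "U = v * r ^ CARD('n)"
  define W where "W = v * (r / 2) ^ CARD('n)"
  have r: "0 < r" using t by (simp add: r_def)
  have v: "0 < v" by (simp add: v_def)
  have U: "0 < U" and W: "0 < W" using r v by (auto simp: U_def W_def)
  have rN: "r ^ CARD('n) = t powr (real CARD('n) / \<theta>)"
    using t by (simp add: r_def powr_powr flip: powr_realpow)
  have ball_le: "(\<integral>\<^sup>+y. indicator (ball z r) y * f y \<partial>lborel) \<le> ennreal (M * U)" for z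
    using le[of z] r M by (simp add: r_def[symmetric] emeasure_ball U_def v_def ennreal_mult)
  \<comment> \<open>The whole estimate is carried out after multiplication by the volume
    \<open>W\<close> of the small ball, which is cancelled at the very end.\<close>
  have pointwise: "ennreal W * (ennreal (G (x - y, t)) * f y)
      \<le> ennreal (W * G (0, t)) * (indicator (ball x r) y * f y)
        + (\<integral>\<^sup>+w. indicator (ball (x - y) r) w * ennreal (G (w, t)) \<partial>lborel) * f y" for y
  proof (cases "norm (x - y) < r")
    case True
    have "ennreal W * ennreal (G (x - y, t)) \<le> ennreal (W * G (0, t))"
      using W bounded_by_origin[OF t] nonneg[OF t] by (simp add: ennreal_leI mult_left_mono flip: ennreal_mult)
    then have "ennreal W * (ennreal (G (x - y, t)) * f y) \<le> ennreal (W * G (0, t)) * (indicator (ball x r) y * f y)"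
      using True by (simp add: dist_norm mult_right_mono flip: mult.assoc)
    then show ?thesis by (simp add: add_increasing2)
  next
    case False
    then have "ennreal W * ennreal (G (x - y, t)) \<le> (\<integral>\<^sup>+w. indicator (ball (x - y) r) w * ennreal (G (w, t)) \<partial>lborel)"
      unfolding W_def v_def using r by (intro le_local_integral t) auto
    then have "ennreal W * (ennreal (G (x - y, t)) * f y) \<le> (\<integral>\<^sup>+w. indicator (ball (x - y) r) w * ennreal (G (w, t)) \<partial>lborel) * f y"
      by (simp add: mult_right_mono flip: mult.assoc)
    then show ?thesis by (simp add: add_increasing)
  qed
  \<comment> \<open>This symmetry between y and w turns the ball in the kernel variable into a ball
    in the variable of \<open>f\<close>.\<close>
  have ball_swap: "indicator (ball (x - y) r) w = (indicator (ball (x - w) r) y :: ennreal)" for y w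
  proof -
    have "norm (x - y - w) = norm (x - w - y)" by (simp add: diff_diff_eq add.commute)
    then show ?thesis by (simp add: indicator_def dist_norm)
  qed
  have ind[measurable]: "(\<lambda>(y, w). indicator (ball (x - y) r) w :: ennreal) \<in> borel_measurable (borel \<Otimes>\<^sub>M borel)"
  proof -
    have "(\<lambda>(y, w). indicator (ball (x - y) r) w :: ennreal) = (\<lambda>p. if dist (x - fst p) (snd p) < r then 1 else 0)"
      by (auto simp: fun_eq_iff split: split_indicator)
    then show ?thesis by simp
  qed
  have "(\<integral>\<^sup>+y. (\<integral>\<^sup>+w. indicator (ball (x - y) r) w * ennreal (G (w, t)) \<partial>lborel) * f y \<partial>lborel)
      = (\<integral>\<^sup>+y. (\<integral>\<^sup>+w. indicator (ball (x - y) r) w * ennreal (G (w, t)) * f y \<partial>lborel) \<partial>lborel)"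
    by (intro nn_integral_cong nn_integral_multc[symmetric]) measurable
  also have "\<dots> = (\<integral>\<^sup>+w. (\<integral>\<^sup>+y. indicator (ball (x - y) r) w * ennreal (G (w, t)) * f y \<partial>lborel) \<partial>lborel)"
    by (rule lborel_pair.Fubini') measurable
  also have "\<dots> = (\<integral>\<^sup>+w. ennreal (G (w, t)) * (\<integral>\<^sup>+y. indicator (ball (x - w) r) y * f y \<partial>lborel) \<partial>lborel)"
  proof (intro nn_integral_cong)
    fix w
    show "(\<integral>\<^sup>+y. indicator (ball (x - y) r) w * ennreal (G (w, t)) * f y \<partial>lborel)
        = ennreal (G (w, t)) * (\<integral>\<^sup>+y. indicator (ball (x - w) r) y * f y \<partial>lborel)"
      by (subst nn_integral_cmult[symmetric], measurable)
        (intro nn_integral_cong, subst ball_swap, simp only: mult_ac)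
  qed
  also have "\<dots> \<le> (\<integral>\<^sup>+w. ennreal (G (w, t)) * ennreal (M * U) \<partial>lborel)"
    by (intro nn_integral_mono mult_left_mono ball_le) auto
  also have "\<dots> = ennreal (M * U)"
    using total_mass[OF t, of 0] nn_integral_lborel_reflect[of "\<lambda>w. ennreal (G (w, t))" 0]
    by (simp add: nn_integral_multc)
  finally have far: "(\<integral>\<^sup>+y. (\<integral>\<^sup>+w. indicator (ball (x - y) r) w * ennreal (G (w, t)) \<partial>lborel) * f y \<partial>lborel) \<le> ennreal (M * U)" .
  have m1: "(\<lambda>y. indicator (ball x r) y * f y) \<in> borel_measurable borel"
    by (intro borel_measurable_times_ennreal borel_measurable_indicator f) auto
  have m2: "(\<lambda>y. (\<integral>\<^sup>+w. indicator (ball (x - y) r) w * ennreal (G (w, t)) \<partial>lborel) * f y) \<in> borel_measurable lborel"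
    by measurable
  have "ennreal W * (\<integral>\<^sup>+y. ennreal (G (x - y, t)) * f y \<partial>lborel) = (\<integral>\<^sup>+y. ennreal W * (ennreal (G (x - y, t)) * f y) \<partial>lborel)"
    by (rule nn_integral_cmult[symmetric]) measurable
  also have "\<dots> \<le> (\<integral>\<^sup>+y. ennreal (W * G (0, t)) * (indicator (ball x r) y * f y)
        + (\<integral>\<^sup>+w. indicator (ball (x - y) r) w * ennreal (G (w, t)) \<partial>lborel) * f y \<partial>lborel)"
    by (intro nn_integral_mono pointwise)
  also have "\<dots> = ennreal (W * G (0, t)) * (\<integral>\<^sup>+y. indicator (ball x r) y * f y \<partial>lborel)
        + (\<integral>\<^sup>+y. (\<integral>\<^sup>+w. indicator (ball (x - y) r) w * ennreal (G (w, t)) \<partial>lborel) * f y \<partial>lborel)"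
    using m1 m2 by (subst nn_integral_add) (auto simp: nn_integral_cmult)
  also have "\<dots> \<le> ennreal (W * G (0, t)) * ennreal (M * U) + ennreal (M * U)"
    by (intro add_mono mult_left_mono ball_le far) auto
  also have "\<dots> = ennreal (W * G (0, t) * (M * U) + M * U)"
    using M U W nonneg[OF t] by (simp add: ennreal_mult)
  also have "W * G (0, t) * (M * U) + M * U = W * (smoothing_constant * M)"
  proof -
    have "G (0, t) * U = v * G (0, 1)"
      using t by (simp add: U_def rN origin_scaling[OF t] powr_minus field_simps)
    moreover have "U = W * 2 ^ CARD('n)"
      by (simp add: U_def W_def power_divide)
    moreover have "W * G (0, t) * (M * U) + M * U = W * M * (G (0, t) * U) + M * U" by simp
    ultimately have "W * G (0, t) * (M * U) + M * U = W * M * (v * G (0, 1)) + M * (W * 2 ^ CARD('n))" by metis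
    then show ?thesis by (simp add: smoothing_constant_def v_def algebra_simps)
  qed
  also have "ennreal (W * (smoothing_constant * M)) = ennreal W * ennreal (smoothing_constant * M)"
    using W M smoothing_constant_pos by (intro ennreal_mult) auto
  finally show ?thesis
    using W by (subst (asm) ennreal_mult_le_mult_iff) auto
qed

end

section \<open>The heat semigroup on nonnegative functions\<close>

lemma ennpowr_ennreal: "0 \<le> r \<Longrightarrow> ennpowr (ennreal r) a = ennreal (r powr a)"
  by (simp add: ennpowr_def)

lemma ennpowr_top [simp]: "ennpowr \<top> a = \<top>"
  by (simp add: ennpowr_def)

lemma ennpowr_mono: "0 \<le> a \<Longrightarrow> x \<le> y \<Longrightarrow> ennpowr x a \<le> ennpowr y a"
  by (cases x; cases y) (auto simp: ennpowr_ennreal top_unique intro!: ennreal_leI powr_mono2)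

lemma ennpowr_ennpowr: "ennpowr (ennpowr x a) b = ennpowr x (a * b)"
  by (cases x) (auto simp: ennpowr_ennreal powr_powr)

lemma ennpowr_one [simp]: "ennpowr x 1 = x"
  by (cases x) (auto simp: ennpowr_ennreal)

lemma borel_measurable_ennpowr [measurable (raw)]:
  assumes [measurable]: "f \<in> borel_measurable M"
  shows "(\<lambda>x. ennpowr (f x) a) \<in> borel_measurable M"
  unfolding ennpowr_def by measurable

text \<open>For a > 0 the power is an order isomorphism, with inverse the power 1/a, and therefore
  commutes with suprema.\<close>

lemma ennpowr_SUP:
  assumes a: "0 < a"
  shows "ennpowr (SUP n. X n) a = (SUP n. ennpowr (X n) a)"
proof (rule antisym)
  have "X n \<le> ennpowr (SUP n. ennpowr (X n) a) (1 / a)" for n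
  proof -
    have "X n = ennpowr (ennpowr (X n) a) (1 / a)" using a by (simp add: ennpowr_ennpowr)
    also have "\<dots> \<le> ennpowr (SUP n. ennpowr (X n) a) (1 / a)"
      using a by (intro ennpowr_mono SUP_upper) auto
    finally show ?thesis .
  qed
  then have "(SUP n. X n) \<le> ennpowr (SUP n. ennpowr (X n) a) (1 / a)" by (intro SUP_least)
  then have "ennpowr (SUP n. X n) a \<le> ennpowr (ennpowr (SUP n. ennpowr (X n) a) (1 / a)) a"
    using a by (intro ennpowr_mono) auto
  then show "ennpowr (SUP n. X n) a \<le> (SUP n. ennpowr (X n) a)"
    using a by (simp add: ennpowr_ennpowr)
  show "(SUP n. ennpowr (X n) a) \<le> ennpowr (SUP n. X n) a"
    using a by (intro SUP_least ennpowr_mono SUP_upper) auto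
qed

text \<open>A linear bound in m^\<alpha>, with equality at m = a. Integrated against a probability
  density, with \<open>a\<close> chosen suitably, it yields Jensen's inequality.\<close>

lemma Young_powr:
  fixes m a \<alpha> :: real
  assumes "1 < \<alpha>" "0 \<le> m" "0 < a"
  shows "m \<le> (1 / \<alpha>) * a powr (1 - \<alpha>) * m powr \<alpha> + (1 - 1 / \<alpha>) * a"
proof (cases "m = 0")
  case True
  then show ?thesis using assms by simp
next
  case False
  then have m: "0 < m" using assms by simp
  have "(a powr (1 - \<alpha>) * m powr \<alpha>) powr (1 / \<alpha>) * a powr (1 - 1 / \<alpha>)
      \<le> (1 / \<alpha>) * (a powr (1 - \<alpha>) * m powr \<alpha>) + (1 - 1 / \<alpha>) * a"
    using assms m by (intro Youngs_inequality_0) auto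
  moreover have "(a powr (1 - \<alpha>) * m powr \<alpha>) powr (1 / \<alpha>) * a powr (1 - 1 / \<alpha>) = m"
  proof -
    have "(a powr (1 - \<alpha>) * m powr \<alpha>) powr (1 / \<alpha>) = a powr ((1 - \<alpha>) / \<alpha>) * m"
      using assms m by (simp add: powr_mult powr_powr)
    moreover have "(1 - 1 / \<alpha>) + (1 - \<alpha>) / \<alpha> = 0" using assms by (simp add: field_simps)
    ultimately show ?thesis using assms by (simp add: powr_add[symmetric] mult.commute mult.left_commute)
  qed
  ultimately show ?thesis by (simp add: mult.assoc)
qed

lemma nn_integral_powr:
  assumes "-1 < a" "0 \<le> t"
  shows "(\<integral>\<^sup>+s. indicator {0<..<t} s * ennreal (s powr a) \<partial>lborel) \<le> ennreal (t powr (a + 1) / (a + 1))"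
proof -
  have "((\<lambda>s. s powr a) has_integral (t powr (a + 1) / (a + 1))) {0..t}"
    using has_integral_powr_from_0[OF assms] .
  then have "(\<integral>\<^sup>+s. ennreal (indicator {0..t} s * s powr a) \<partial>lborel) = ennreal (t powr (a + 1) / (a + 1))"
    using assms nn_integral_has_integral_lebesgue[of "{0..t}" "\<lambda>s. s powr a"] by (auto simp: nn_integral_completion)
  moreover have "(\<integral>\<^sup>+s. indicator {0<..<t} s * ennreal (s powr a) \<partial>lborel)
      \<le> (\<integral>\<^sup>+s. ennreal (indicator {0..t} s * s powr a) \<partial>lborel)"
    by (intro nn_integral_mono) (auto split: split_indicator)
  ultimately show ?thesis by simp
qed

lemma borel_measurable_fst [measurable]: "fst \<in> borel_measurable (borel :: ('a::topological_space \<times> 'b::topological_space) measure)"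
  by (intro borel_measurable_continuous_onI continuous_intros)

lemma borel_measurable_snd [measurable]: "snd \<in> borel_measurable (borel :: ('a::topological_space \<times> 'b::topological_space) measure)"
  by (intro borel_measurable_continuous_onI continuous_intros)

section \<open>The operators S(t) and Jensen's inequality\<close>

context fractional_heat_kernel begin

text \<open>Cutting off at t \<le> 0, where nothing is known about \<open>G\<close>, gives a Borel
  function on all of space-time, so that Tonelli applies to joint integrals.\<close>

definition kernel :: "(real ^ 'n) \<times> real \<Rightarrow> ennreal" where
  "kernel z = ennreal (indicator (UNIV \<times> {0<..}) z *\<^sub>R G z)"

lemma kernel_eq: "0 < t \<Longrightarrow> kernel (x, t) = ennreal (G (x, t))"
  by (simp add: kernel_def)

lemma borel_measurable_kernel [measurable]: "kernel \<in> borel_measurable borel"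
proof -
  have "(UNIV \<times> {0<..} :: ((real ^ 'n) \<times> real) set) \<in> sets borel"
    by (intro borel_open open_Times) auto
  then show ?thesis
    unfolding kernel_def[abs_def]
    by (intro measurable_compose[OF _ measurable_ennreal] borel_measurable_continuous_on_indicator continuous)
qed

text \<open>This is S(t) of the overview; it vanishes for t \<le> 0 together with
  \<open>kernel\<close>.\<close>

definition heat :: "(real ^ 'n \<Rightarrow> ennreal) \<Rightarrow> real ^ 'n \<Rightarrow> real \<Rightarrow> ennreal" where
  "heat f x t = (\<integral>\<^sup>+y. kernel (x - y, t) * f y \<partial>lborel)"

lemma heat_measurable_slice:
  assumes [measurable]: "f \<in> borel_measurable borel"
  shows "(\<lambda>x. heat f x t) \<in> borel_measurable borel"
  unfolding heat_def by measurable

lemma heat_measurable: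
  assumes [measurable]: "f \<in> borel_measurable borel"
  shows "(\<lambda>z. heat f (fst z) (snd z)) \<in> borel_measurable borel"
  unfolding heat_def by measurable

lemma heat_mono: "(\<And>y. f y \<le> g y) \<Longrightarrow> heat f x t \<le> heat g x t"
  unfolding heat_def by (intro nn_integral_mono mult_left_mono) auto

lemma heat_cmult:
  assumes [measurable]: "f \<in> borel_measurable borel"
  shows "heat (\<lambda>y. c * f y) x t = c * heat f x t"
  unfolding heat_def by (subst nn_integral_cmult[symmetric], measurable) (intro nn_integral_cong mult.left_commute)

lemma heat_heat:
  assumes t: "0 < t" and s: "0 < s" and [measurable]: "f \<in> borel_measurable borel"
  shows "heat (\<lambda>y. heat f y s) x t = heat f x (t + s)"
proof -
  have "heat (\<lambda>y. heat f y s) x t = (\<integral>\<^sup>+y. (\<integral>\<^sup>+z. kernel (x - y, t) * (kernel (y - z, s) * f z) \<partial>lborel) \<partial>lborel)"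
    unfolding heat_def by (intro nn_integral_cong nn_integral_cmult[symmetric]) measurable
  also have "\<dots> = (\<integral>\<^sup>+z. (\<integral>\<^sup>+y. kernel (x - y, t) * (kernel (y - z, s) * f z) \<partial>lborel) \<partial>lborel)"
    by (rule lborel_pair.Fubini') measurable
  also have "\<dots> = (\<integral>\<^sup>+z. kernel (x - z, t + s) * f z \<partial>lborel)"
  proof (intro nn_integral_cong)
    fix z
    have "(\<integral>\<^sup>+y. kernel (x - y, t) * (kernel (y - z, s) * f z) \<partial>lborel)
        = (\<integral>\<^sup>+y. kernel (x - y, t) * kernel (y - z, s) \<partial>lborel) * f z"
      by (subst nn_integral_multc[symmetric], measurable) (simp add: mult.assoc)
    then show "(\<integral>\<^sup>+y. kernel (x - y, t) * (kernel (y - z, s) * f z) \<partial>lborel) = kernel (x - z, t + s) * f z"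
      using t s by (simp add: kernel_eq semigroup_nn)
  qed
  finally show ?thesis unfolding heat_def .
qed

text \<open>Let r be the value of S(t) m^\<alpha> at \<open>x\<close>. For r > 0,
  \<open>Young_powr\<close> with a = r^(1/\<alpha>) is integrated against the unit mass of the
  kernel, and the right-hand side sums to a. For r = 0 that choice is not positive, but then m
  vanishes almost everywhere with respect to the kernel.\<close>

lemma heat_Jensen:
  assumes t: "0 < t" and \<alpha>: "1 < \<alpha>" and m[measurable]: "m \<in> borel_measurable borel" and m0: "\<And>y. 0 \<le> m y"
    and fin: "heat (\<lambda>y. ennreal (m y powr \<alpha>)) x t < \<top>"
  shows "heat (\<lambda>y. ennreal (m y)) x t \<le> ennpowr (heat (\<lambda>y. ennreal (m y powr \<alpha>)) x t) (1 / \<alpha>)"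
proof -
  obtain r where r: "0 \<le> r" "heat (\<lambda>y. ennreal (m y powr \<alpha>)) x t = ennreal r"
    using fin by (cases "heat (\<lambda>y. ennreal (m y powr \<alpha>)) x t") auto
  show ?thesis
  proof (cases "r = 0")
    case True
    have "(\<integral>\<^sup>+y. kernel (x - y, t) * ennreal (m y powr \<alpha>) \<partial>lborel) = 0"
      using r True by (simp add: heat_def)
    then have "AE y in lborel. kernel (x - y, t) * ennreal (m y powr \<alpha>) = 0"
      by (subst (asm) nn_integral_0_iff_AE) auto
    then have "AE y in lborel. kernel (x - y, t) * ennreal (m y) = 0"
      by eventually_elim (use m0 in \<open>auto simp: ennreal_eq_0_iff\<close>)
    then have "heat (\<lambda>y. ennreal (m y)) x t = 0"
      unfolding heat_def by (subst nn_integral_0_iff_AE) auto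
    then show ?thesis by simp
  next
    case False
    define a where "a = r powr (1 / \<alpha>)"
    have rp: "0 < r" and a: "0 < a" using r False by (auto simp: a_def)
    have "heat (\<lambda>y. ennreal (m y)) x t
        \<le> (\<integral>\<^sup>+y. ennreal ((1 / \<alpha>) * a powr (1 - \<alpha>)) * (kernel (x - y, t) * ennreal (m y powr \<alpha>))
            + ennreal ((1 - 1 / \<alpha>) * a) * kernel (x - y, t) \<partial>lborel)"
      unfolding heat_def
    proof (intro nn_integral_mono)
      fix y
      have "ennreal (m y) \<le> ennreal ((1 / \<alpha>) * a powr (1 - \<alpha>) * m y powr \<alpha> + (1 - 1 / \<alpha>) * a)"
        by (intro ennreal_leI Young_powr \<alpha> m0 a)
      also have "\<dots> = ennreal ((1 / \<alpha>) * a powr (1 - \<alpha>)) * ennreal (m y powr \<alpha>) + ennreal ((1 - 1 / \<alpha>) * a)"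
        using \<alpha> a by (subst ennreal_plus) (auto simp flip: ennreal_mult)
      finally have "kernel (x - y, t) * ennreal (m y)
          \<le> kernel (x - y, t) * (ennreal ((1 / \<alpha>) * a powr (1 - \<alpha>)) * ennreal (m y powr \<alpha>) + ennreal ((1 - 1 / \<alpha>) * a))"
        by (rule mult_left_mono) simp
      then show "kernel (x - y, t) * ennreal (m y)
          \<le> ennreal ((1 / \<alpha>) * a powr (1 - \<alpha>)) * (kernel (x - y, t) * ennreal (m y powr \<alpha>))
            + ennreal ((1 - 1 / \<alpha>) * a) * kernel (x - y, t)"
        by (simp only: distrib_left mult_ac)
    qed
    also have "\<dots> = ennreal ((1 / \<alpha>) * a powr (1 - \<alpha>)) * ennreal r + ennreal ((1 - 1 / \<alpha>) * a) * 1"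
    proof -
      have "(\<integral>\<^sup>+y. kernel (x - y, t) \<partial>lborel) = 1"
        using total_mass[OF t] by (simp add: kernel_eq[OF t])
      then show ?thesis
        using r(2) unfolding heat_def by (subst nn_integral_add) (auto simp: nn_integral_cmult)
    qed
    also have "\<dots> = ennreal ((1 / \<alpha>) * a powr (1 - \<alpha>) * r + (1 - 1 / \<alpha>) * a)"
      using \<alpha> a r by (subst ennreal_plus) (auto simp flip: ennreal_mult)
    also have "(1 / \<alpha>) * a powr (1 - \<alpha>) * r + (1 - 1 / \<alpha>) * a = a"
    proof -
      have "r = a powr \<alpha>" using \<alpha> rp by (simp add: a_def powr_powr)
      then have "a powr (1 - \<alpha>) * r = a" using a by (simp add: powr_add[symmetric])
      then show ?thesis by (simp add: mult.assoc left_diff_distrib)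
    qed
    finally show ?thesis using r by (simp add: ennpowr_ennreal a_def)
  qed
qed

end

section \<open>The integral equation\<close>

context fractional_heat_kernel begin

definition duhamel :: "real \<Rightarrow> ((real ^ 'n) \<times> real \<Rightarrow> ennreal) \<Rightarrow> (real ^ 'n) \<times> real \<Rightarrow> ennreal" where
  "duhamel p u z = (\<integral>\<^sup>+s. indicator {0<..<snd z} s * heat (\<lambda>y. ennpowr (u (y, s)) p) (fst z) (snd z - s) \<partial>lborel)"

lemma duhamel_measurable [measurable]:
  assumes [measurable]: "u \<in> borel_measurable borel"
  shows "duhamel p u \<in> borel_measurable borel"
proof -
  have [measurable]: "(\<lambda>(z, s). indicator {0<..<snd z} s :: ennreal)
      \<in> borel_measurable ((borel :: ((real ^ 'n) \<times> real) measure) \<Otimes>\<^sub>M borel)"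
  proof -
    have "(\<lambda>(z, s). indicator {0<..<snd z} s :: ennreal) = (\<lambda>q :: ((real ^ 'n) \<times> real) \<times> real. if 0 < snd q \<and> snd q < snd (fst q) then 1 else 0)"
      by (auto simp: fun_eq_iff split: split_indicator)
    then show ?thesis by simp
  qed
  show ?thesis
    unfolding duhamel_def[abs_def] heat_def by measurable
qed

lemma duhamel_integrand_measurable:
  assumes [measurable]: "u \<in> borel_measurable borel"
  shows "(\<lambda>s. indicator {0<..<t} s * heat (\<lambda>y. ennpowr (u (y, s)) p) x (t - s)) \<in> borel_measurable borel"
  unfolding heat_def by measurable

lemma duhamel_mono:
  assumes p: "0 \<le> p" and le: "\<And>y s. 0 < s \<Longrightarrow> s < t \<Longrightarrow> u (y, s) \<le> v (y, s)"
  shows "duhamel p u (x, t) \<le> duhamel p v (x, t)"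
  unfolding duhamel_def
proof (intro nn_integral_mono)
  fix s
  show "indicator {0<..<snd (x, t)} s * heat (\<lambda>y. ennpowr (u (y, s)) p) (fst (x, t)) (snd (x, t) - s)
     \<le> indicator {0<..<snd (x, t)} s * heat (\<lambda>y. ennpowr (v (y, s)) p) (fst (x, t)) (snd (x, t) - s)"
    using le p by (auto split: split_indicator intro!: heat_mono ennpowr_mono)
qed

text \<open>Monotone convergence in space and then in time, after the power has been moved inside
  the supremum.\<close>

lemma duhamel_SUP:
  assumes p: "0 < p" and u[measurable]: "\<And>n. u n \<in> borel_measurable borel" and inc: "incseq u"
  shows "duhamel p (\<lambda>z. SUP n. u n z) z = (SUP n. duhamel p (u n) z)"
proof -
  obtain x t where z: "z = (x, t)" by (cases z)
  have inc': "u m z \<le> u n z" if "m \<le> n" for m n z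
    using inc that unfolding incseq_def le_fun_def by blast
  have "heat (\<lambda>y. ennpowr (SUP n. u n (y, s)) p) x (t - s) = (SUP n. heat (\<lambda>y. ennpowr (u n (y, s)) p) x (t - s))" for s
  proof -
    have "heat (\<lambda>y. ennpowr (SUP n. u n (y, s)) p) x (t - s)
       = (\<integral>\<^sup>+y. (SUP n. kernel (x - y, t - s) * ennpowr (u n (y, s)) p) \<partial>lborel)"
      unfolding heat_def by (simp add: ennpowr_SUP[OF p] SUP_mult_left_ennreal)
    also have "\<dots> = (SUP n. \<integral>\<^sup>+y. kernel (x - y, t - s) * ennpowr (u n (y, s)) p \<partial>lborel)"
      using p inc' by (intro nn_integral_monotone_convergence_SUP)
        (auto simp: incseq_def le_fun_def intro!: mult_left_mono ennpowr_mono)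
    finally show ?thesis unfolding heat_def .
  qed
  then have "duhamel p (\<lambda>z. SUP n. u n z) z
      = (\<integral>\<^sup>+s. (SUP n. indicator {0<..<t} s * heat (\<lambda>y. ennpowr (u n (y, s)) p) x (t - s)) \<partial>lborel)"
    unfolding duhamel_def z by (simp add: SUP_mult_left_ennreal)
  also have "\<dots> = (SUP n. \<integral>\<^sup>+s. indicator {0<..<t} s * heat (\<lambda>y. ennpowr (u n (y, s)) p) x (t - s) \<partial>lborel)"
    using p inc' duhamel_integrand_measurable[OF u] by (intro nn_integral_monotone_convergence_SUP)
      (auto simp: incseq_def le_fun_def intro!: mult_left_mono heat_mono ennpowr_mono)
  finally show ?thesis by (simp add: duhamel_def z)
qed

text \<open>A pointwise supersolution dominates the monotone Picard iteration, whose limit then solves the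
  integral equation.\<close>

lemma solution_below_supersolution:
  assumes p: "0 < p" and f[measurable]: "f \<in> borel_measurable borel"
    and super: "\<And>x t. 0 < t \<Longrightarrow> ennreal t < T \<Longrightarrow> heat f x t + duhamel p v (x, t) \<le> v (x, t)"
  obtains u where "u \<in> borel_measurable borel"
    and "\<And>x t. u (x, t) = heat f x t + duhamel p u (x, t)"
    and "\<And>x t. 0 < t \<Longrightarrow> ennreal t < T \<Longrightarrow> u (x, t) \<le> v (x, t)"
proof -
  define F where "F u z = heat f (fst z) (snd z) + duhamel p u z" for u z
  define u where "u n = (F ^^ n) (\<lambda>_. 0)" for n
  have uS: "u (Suc n) = F (u n)" for n by (simp add: u_def)
  have u0: "u 0 = (\<lambda>_. 0)" by (simp add: u_def)
  have um[measurable]: "u n \<in> borel_measurable borel" for n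
  proof (induction n)
    case (Suc n)
    note Suc.IH[measurable] heat_measurable[OF f, measurable]
    show ?case unfolding uS F_def[abs_def] by measurable
  qed (simp add: u0)
  have "u n \<le> u (Suc n)" for n
  proof (induction n)
    case (Suc n)
    then show ?case
      using p unfolding uS[of "Suc n"] uS[of n]
      by (auto simp: F_def le_fun_def intro!: add_left_mono duhamel_mono)
  qed (simp add: u0 le_fun_def)
  then have inc: "incseq u" by (rule incseq_SucI)
  define U where "U z = (SUP n. u n z)" for z
  have le: "u n (x, t) \<le> v (x, t)" if "0 < t" "ennreal t < T" for n x t
    using that
  proof (induction n arbitrary: x t)
    case (Suc n)
    have "duhamel p (u n) (x, t) \<le> duhamel p v (x, t)"
    proof (rule duhamel_mono)
      \<comment> \<open>The Duhamel term at time \<open>t\<close> sees only times s < t, which also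
        lie below \<open>T\<close>, so the induction hypothesis applies.\<close>
      fix y s assume "0 < s" "s < t"
      then show "u n (y, s) \<le> v (y, s)"
        using Suc.prems le_less_trans[OF ennreal_leI[of s t], of T] by (intro Suc.IH) auto
    qed (use p in simp)
    then have "u (Suc n) (x, t) \<le> heat f x t + duhamel p v (x, t)"
      by (simp add: uS F_def add_left_mono)
    also have "\<dots> \<le> v (x, t)" by (rule super[OF Suc.prems])
    finally show ?case .
  qed (simp add: u0)
  show ?thesis
  proof
    show "U \<in> borel_measurable borel" unfolding U_def[abs_def] by measurable
    \<comment> \<open>The equation is proved in [0,infinity] at every point; finiteness is a
      consequence of the bound by \<open>v\<close> alone.\<close>
    show "U (x, t) = heat f x t + duhamel p U (x, t)" for x t
    proof -
      have incd: "incseq (\<lambda>n. duhamel p (u n) (x, t))"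
        using p inc by (auto simp: incseq_def le_fun_def intro!: duhamel_mono)
      have "U (x, t) = (SUP n. u (Suc n) (x, t))"
        unfolding U_def
      proof (rule antisym)
        show "(SUP n. u n (x, t)) \<le> (SUP n. u (Suc n) (x, t))"
          using \<open>\<And>n. u n \<le> u (Suc n)\<close> by (intro SUP_mono) (auto simp: le_fun_def)
        show "(SUP n. u (Suc n) (x, t)) \<le> (SUP n. u n (x, t))"
          by (intro SUP_least SUP_upper) auto
      qed
      also have "\<dots> = (SUP n. heat f x t + duhamel p (u n) (x, t))"
        by (simp add: uS F_def)
      also have "\<dots> = heat f x t + (SUP n. duhamel p (u n) (x, t))"
        using ennreal_SUP_add[of "\<lambda>_. heat f x t" "\<lambda>n. duhamel p (u n) (x, t)"] incd by simp
      also have "(SUP n. duhamel p (u n) (x, t)) = duhamel p U (x, t)"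
        unfolding U_def[abs_def] by (rule duhamel_SUP[OF p um inc, symmetric])
      finally show ?thesis .
    qed
    show "U (x, t) \<le> v (x, t)" if "0 < t" "ennreal t < T" for x t
      unfolding U_def using le[OF that] by (intro SUP_least)
  qed
qed

text \<open>One factor of W(s) in the source term is kept for the semigroup, which carries it to
  W(t) whatever s is; the others are bounded by a power of s. After the time integration, W(t) is
  split once more, so that one part cancels the power of t and the part W(t)^(1/\<alpha>)
  remains.\<close>

lemma supersolution:
  fixes \<alpha> p A :: real and m :: "real ^ 'n \<Rightarrow> real" and T :: ennreal
  defines "W \<equiv> heat (\<lambda>y. ennreal (m y powr \<alpha>))"
  assumes \<alpha>: "1 < \<alpha>" "\<alpha> < p" and m[measurable]: "m \<in> borel_measurable borel" and m0: "\<And>y. 0 \<le> m y"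
    and A: "0 < A" "2 powr p * ((p - 1) / (\<alpha> - 1)) * A powr ((p - 1) / \<alpha>) \<le> 1"
    and W: "\<And>x t. 0 < t \<Longrightarrow> ennreal t < T \<Longrightarrow> W x t \<le> ennreal (A * t powr (- \<alpha> / (p - 1)))"
    and t: "0 < t" "ennreal t < T"
  shows "heat (\<lambda>y. ennreal (m y)) x t + duhamel p (\<lambda>(y, s). 2 * ennpowr (W y s) (1 / \<alpha>)) (x, t)
      \<le> 2 * ennpowr (W x t) (1 / \<alpha>)"
proof -
  \<comment> \<open>\<open>k\<close> is the decay exponent of W. The excess power W(s)^((p -
    \<alpha>)/\<alpha>) contributes the exponent b = -k (p - \<alpha>)/\<alpha>, and
    \<open>K\<close> collects the constants of the source term.\<close>
  define k where "k = \<alpha> / (p - 1)"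
  define K where "K = 2 powr p * A powr ((p - \<alpha>) / \<alpha>)"
  define b where "b = - ((p - \<alpha>) / (p - 1))"
  \<comment> \<open>The condition b > -1, needed for the time integral near 0, is exactly \<alpha> >
    1.\<close>
  have b: "-1 < b" "b + 1 = (\<alpha> - 1) / (p - 1)" using \<alpha> by (auto simp: b_def field_simps)
  have K: "0 \<le> K" by (simp add: K_def)
  have k: "- \<alpha> / (p - 1) = - k" by (simp add: k_def)
  have Wr: "\<exists>r\<ge>0. W y s = ennreal r \<and> r \<le> A * s powr (- k)" if "0 < s" "ennreal s < T" for y s
  proof -
    have "W y s \<le> ennreal (A * s powr (- k))" using W[OF that] k by simp
    then show ?thesis using A(1) by (cases "W y s") (auto simp: top_unique)
  qed
  have [measurable]: "(\<lambda>z. W (fst z) (snd z)) \<in> borel_measurable borel"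
    unfolding W_def by (rule heat_measurable) measurable
  have [measurable]: "(\<lambda>y. W y s) \<in> borel_measurable borel" for s
    unfolding W_def by (rule heat_measurable_slice) measurable
  have source: "ennpowr (2 * ennpowr (W y s) (1 / \<alpha>)) p \<le> ennreal (K * s powr b) * W y s"
    if s: "0 < s" "ennreal s < T" for y s
  proof -
    obtain r where r: "0 \<le> r" "W y s = ennreal r" "r \<le> A * s powr (- k)" using Wr[OF s] by blast
    have "(2::ennreal) * ennpowr (W y s) (1 / \<alpha>) = ennreal (2 * r powr (1 / \<alpha>))"
      using r by (simp add: ennpowr_ennreal ennreal_mult)
    then have "ennpowr (2 * ennpowr (W y s) (1 / \<alpha>)) p = ennreal ((2 * r powr (1 / \<alpha>)) powr p)"
      by (simp add: ennpowr_ennreal)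
    also have "(2 * r powr (1 / \<alpha>)) powr p = 2 powr p * r powr (p / \<alpha>)"
      by (simp add: powr_mult powr_powr)
    also have "r powr (p / \<alpha>) = r powr ((p - \<alpha>) / \<alpha>) * r"
    proof -
      have "p / \<alpha> = (p - \<alpha>) / \<alpha> + 1" using \<alpha> by (simp add: field_simps)
      then show ?thesis using r by (cases "r = 0") (simp_all add: powr_add)
    qed
    \<comment> \<open>Since \<alpha> < p, the exponent is positive and the decay bound on W can be
      inserted.\<close>
    also have "2 powr p * (r powr ((p - \<alpha>) / \<alpha>) * r) \<le> 2 powr p * ((A * s powr (- k)) powr ((p - \<alpha>) / \<alpha>) * r)"
      using r \<alpha> by (intro mult_left_mono mult_right_mono powr_mono2) auto
    also have "(A * s powr (- k)) powr ((p - \<alpha>) / \<alpha>) = A powr ((p - \<alpha>) / \<alpha>) * s powr b"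
      using A \<alpha> by (simp add: powr_mult powr_powr b_def k_def)
    finally have "ennpowr (2 * ennpowr (W y s) (1 / \<alpha>)) p \<le> ennreal (K * s powr b * r)"
      by (simp add: K_def mult_ac ennreal_leI)
    then show ?thesis using r K by (simp add: ennreal_mult)
  qed
  have "duhamel p (\<lambda>(y, s). 2 * ennpowr (W y s) (1 / \<alpha>)) (x, t)
      \<le> (\<integral>\<^sup>+s. indicator {0<..<t} s * ennreal (s powr b) * (ennreal K * W x t) \<partial>lborel)"
    unfolding duhamel_def
  proof (intro nn_integral_mono)
    fix s
    show "indicator {0<..<snd (x, t)} s * heat (\<lambda>y. ennpowr (case (y, s) of (y, s) \<Rightarrow> 2 * ennpowr (W y s) (1 / \<alpha>)) p) (fst (x, t)) (snd (x, t) - s)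
        \<le> indicator {0<..<t} s * ennreal (s powr b) * (ennreal K * W x t)"
    proof (cases "0 < s \<and> s < t")
      case True
      then have s: "0 < s" "s < t" "ennreal s < T" using t le_less_trans[OF ennreal_leI[of s t], of T] by auto
      have "heat (\<lambda>y. ennpowr (2 * ennpowr (W y s) (1 / \<alpha>)) p) x (t - s) \<le> heat (\<lambda>y. ennreal (K * s powr b) * W y s) x (t - s)"
        by (intro heat_mono source s)
      also have "\<dots> = ennreal (K * s powr b) * heat (\<lambda>y. W y s) x (t - s)"
        by (intro heat_cmult) measurable
      \<comment> \<open>By the semigroup property only the factor s^b still depends on s.\<close>
      also have "heat (\<lambda>y. W y s) x (t - s) = W x t"
        unfolding W_def using s by (subst heat_heat) auto
      finally show ?thesis using True K by (simp add: ennreal_mult mult_ac)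
    qed auto
  qed
  also have "\<dots> = (\<integral>\<^sup>+s. indicator {0<..<t} s * ennreal (s powr b) \<partial>lborel) * (ennreal K * W x t)"
    by (rule nn_integral_multc) measurable
  also have "\<dots> \<le> ennreal (t powr (b + 1) / (b + 1)) * (ennreal K * W x t)"
    using b t by (intro mult_right_mono nn_integral_powr) auto
  also have "\<dots> \<le> ennpowr (W x t) (1 / \<alpha>)"
  proof -
    obtain r where r: "0 \<le> r" "W x t = ennreal r" "r \<le> A * t powr (- k)" using Wr[OF t] by blast
    \<comment> \<open>The first factor is the target; the second, by the decay bound, contributes
      t^(-(b + 1)) and cancels the result of the time integration.\<close>
    have "r = r powr (1 / \<alpha>) * r powr ((\<alpha> - 1) / \<alpha>)"
    proof -
      have "1 / \<alpha> + (\<alpha> - 1) / \<alpha> = 1" using \<alpha> by (simp add: field_simps)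
      then show ?thesis using r(1) by (simp add: powr_add[symmetric])
    qed
    also have "\<dots> \<le> r powr (1 / \<alpha>) * (A * t powr (- k)) powr ((\<alpha> - 1) / \<alpha>)"
      using r \<alpha> by (intro mult_left_mono powr_mono2) auto
    also have "(A * t powr (- k)) powr ((\<alpha> - 1) / \<alpha>) = A powr ((\<alpha> - 1) / \<alpha>) * t powr (- (b + 1))"
      using A \<alpha> by (simp add: powr_mult powr_powr b(2) k_def)
    finally have "t powr (b + 1) / (b + 1) * (K * r)
        \<le> t powr (b + 1) / (b + 1) * (K * (r powr (1 / \<alpha>) * (A powr ((\<alpha> - 1) / \<alpha>) * t powr (- (b + 1)))))"
      using b(1) K by (intro mult_left_mono) auto
    also have "\<dots> = r powr (1 / \<alpha>) * ((K * A powr ((\<alpha> - 1) / \<alpha>) / (b + 1)) * (t powr (b + 1) * t powr (- (b + 1))))"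
      by (simp add: mult_ac)
    also have "t powr (b + 1) * t powr (- (b + 1)) = 1"
      using t by (simp add: powr_add[symmetric])
    also have "K * A powr ((\<alpha> - 1) / \<alpha>) / (b + 1) = 2 powr p * ((p - 1) / (\<alpha> - 1)) * A powr ((p - 1) / \<alpha>)"
    proof -
      have "(p - \<alpha>) / \<alpha> + (\<alpha> - 1) / \<alpha> = (p - 1) / \<alpha>" by (simp add: add_divide_distrib[symmetric])
      then have "A powr ((p - \<alpha>) / \<alpha>) * A powr ((\<alpha> - 1) / \<alpha>) = A powr ((p - 1) / \<alpha>)"
        by (simp add: powr_add[symmetric])
      then have "K * A powr ((\<alpha> - 1) / \<alpha>) = 2 powr p * A powr ((p - 1) / \<alpha>)"
        by (simp add: K_def mult.assoc)
      then show ?thesis by (simp add: b(2))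
    qed
    \<comment> \<open>This is where the smallness of \<open>A\<close> enters.\<close>
    also have "r powr (1 / \<alpha>) * ((2 powr p * ((p - 1) / (\<alpha> - 1)) * A powr ((p - 1) / \<alpha>)) * 1) \<le> r powr (1 / \<alpha>) * 1"
      using A(2) by (intro mult_left_mono) auto
    finally have "t powr (b + 1) / (b + 1) * (K * r) \<le> r powr (1 / \<alpha>)" by simp
    then have "ennreal (t powr (b + 1) / (b + 1) * (K * r)) \<le> ennreal (r powr (1 / \<alpha>))"
      by (rule ennreal_leI)
    moreover have "ennreal (t powr (b + 1) / (b + 1) * (K * r)) = ennreal (t powr (b + 1) / (b + 1)) * (ennreal K * ennreal r)"
      using r(1) b(1) K by (subst ennreal_mult) (auto simp: ennreal_mult)
    ultimately show ?thesis
      unfolding r(2) ennpowr_ennreal[OF r(1)] by (simp only:)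
  qed
  finally have "duhamel p (\<lambda>(y, s). 2 * ennpowr (W y s) (1 / \<alpha>)) (x, t) \<le> ennpowr (W x t) (1 / \<alpha>)" .
  \<comment> \<open>The linear and the Duhamel term each cost one copy of W^(1/\<alpha>), which
    explains the factor 2.\<close>
  moreover have "heat (\<lambda>y. ennreal (m y)) x t \<le> ennpowr (W x t) (1 / \<alpha>)"
    using Wr[OF t, of x] \<alpha> t m0 unfolding W_def by (intro heat_Jensen) auto
  ultimately show ?thesis by (simp add: add_mono mult_2)
qed

end

section \<open>Existence\<close>

text \<open>Lets a Lebesgue measurable \<mu> be replaced by a Borel representative; truncation at 0
  makes the latter nonnegative everywhere.\<close>

lemma completion_ex_borel_measurable_nonneg:
  fixes g :: "'a \<Rightarrow> real"
  assumes "g \<in> borel_measurable (completion M)" "\<And>x. 0 \<le> g x"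
  obtains h where "h \<in> borel_measurable M" "\<And>x. 0 \<le> h x" "AE x in M. g x = h x"
proof -
  obtain h where h: "h \<in> borel_measurable M" "AE x in M. g x = h x"
    using completion_ex_borel_measurable_real[OF assms(1)] by auto
  have "AE x in M. g x = max 0 (h x)"
    using h(2) by eventually_elim (use assms(2) in \<open>metis max.absorb2\<close>)
  then show ?thesis
    using h(1) by (intro that[of "\<lambda>x. max 0 (h x)"]) auto
qed

context fractional_heat_kernel begin

text \<open>Passes from Borel functions and \<open>lborel\<close> to the Lebesgue integrals of the
  definition. Changing \<mu> on a null set does not affect the linear term, and the equation then
  holds at every point of the strip.\<close>

lemma is_solution_borelI:
  assumes \<mu>: "\<mu> \<in> borel_measurable lebesgue" "\<And>y. 0 \<le> \<mu> y"
    and m[measurable]: "m \<in> borel_measurable borel" and ae: "AE y in lborel. \<mu> y = m y"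
    and u: "u \<in> borel_measurable borel"
    and eq: "\<And>x t. u (x, t) = heat (\<lambda>y. ennreal (m y)) x t + duhamel p u (x, t)"
    and fin: "\<And>x t. 0 < t \<Longrightarrow> ennreal t < T \<Longrightarrow> u (x, t) < \<top>"
  shows "is_solution G p (density lebesgue (\<lambda>y. ennreal (\<mu> y))) T u"
  unfolding is_solution_def
proof
  have "u \<in> borel_measurable lebesgue" using u by (intro measurable_completion) simp
  then show "u \<in> borel_measurable (lebesgue_on (strip T))" by (rule measurable_restrict_space1)
  have linear: "(\<integral>\<^sup>+y. ennreal (G (x - y, t)) \<partial>density lebesgue (\<lambda>y. ennreal (\<mu> y))) = heat (\<lambda>y. ennreal (m y)) x t"
    if t: "0 < t" for x t
  proof -
    have [measurable]: "(\<lambda>x. G (x, t)) \<in> borel_measurable borel" using t by auto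
    have "(\<lambda>y. ennreal (G (x - y, t))) \<in> borel_measurable lebesgue"
      by (intro measurable_completion) measurable
    then have "(\<integral>\<^sup>+y. ennreal (G (x - y, t)) \<partial>density lebesgue (\<lambda>y. ennreal (\<mu> y)))
        = (\<integral>\<^sup>+y. ennreal (\<mu> y) * ennreal (G (x - y, t)) \<partial>lebesgue)"
      using \<mu>(1) by (intro nn_integral_density) auto
    also have "\<dots> = (\<integral>\<^sup>+y. ennreal (\<mu> y) * ennreal (G (x - y, t)) \<partial>lborel)"
      by (rule nn_integral_completion)
    also have "\<dots> = heat (\<lambda>y. ennreal (m y)) x t"
      unfolding heat_def using ae by (intro nn_integral_cong_AE) (auto simp: kernel_eq[OF t] mult.commute)
    finally show ?thesis .
  qed
  have nonlinear: "(\<integral>\<^sup>+s\<in>{0<..<t}. (\<integral>\<^sup>+y. ennreal (G (x - y, t - s)) * ennpowr (u (y, s)) p \<partial>lebesgue) \<partial>lebesgue)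
      = duhamel p u (x, t)" for x t
    unfolding duhamel_def heat_def nn_integral_completion
    by (intro nn_integral_cong) (auto simp: kernel_eq split: split_indicator)
  show "AE (x, t) in lebesgue_on (strip T).
        u (x, t) < \<infinity> \<and>
        u (x, t) = (\<integral>\<^sup>+y. ennreal (G (x - y, t)) \<partial>density lebesgue (\<lambda>y. ennreal (\<mu> y)))
          + (\<integral>\<^sup>+s\<in>{0<..<t}. (\<integral>\<^sup>+y. ennreal (G (x - y, t - s)) * ennpowr (u (y, s)) p \<partial>lebesgue) \<partial>lebesgue)"
  proof (rule AE_I2, clarify)
    fix x t
    assume "(x, t) \<in> space (lebesgue_on (strip T) :: ((real ^ 'n) \<times> real) measure)"
    then have t: "0 < t" "ennreal t < T" by (auto simp: strip_def)
    show "u (x, t) < \<infinity> \<and>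
        u (x, t) = (\<integral>\<^sup>+y. ennreal (G (x - y, t)) \<partial>density lebesgue (\<lambda>y. ennreal (\<mu> y)))
          + (\<integral>\<^sup>+s\<in>{0<..<t}. (\<integral>\<^sup>+y. ennreal (G (x - y, t - s)) * ennpowr (u (y, s)) p \<partial>lebesgue) \<partial>lebesgue)"
      unfolding linear[OF t(1)] nonlinear infinity_ennreal_def using fin[OF t] eq by blast
  qed
qed

text \<open>At time \<open>t\<close> the hypothesis is applied at the single radius \<sigma> =
  t^(1/\<theta>), the scale on which \<open>smoothing\<close> works. Raising it to the power
  \<alpha> turns it into a bound on the averages of m^\<alpha>.\<close>

lemma heat_le_of_ball_averages:
  fixes T :: ennreal
  assumes \<alpha>: "1 < \<alpha>" "\<alpha> < p" and m[measurable]: "m \<in> borel_measurable borel"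
    and ae: "AE y in lborel. \<mu> y = m y" and \<gamma>: "0 < \<gamma>"
    and averages: "\<And>\<sigma>::real. 0 < \<sigma> \<Longrightarrow> ennreal \<sigma> < ennpowr T (1 / \<theta>) \<Longrightarrow>
              (SUP z. ennpowr ((\<integral>\<^sup>+y\<in>ball z \<sigma>. ennreal (\<mu> y powr \<alpha>) \<partial>lebesgue)
                                 / emeasure lebesgue (ball z \<sigma>)) (1 / \<alpha>))
                \<le> ennreal (\<gamma> * \<sigma> powr (- \<theta> / (p - 1)))"
    and t: "0 < t" "ennreal t < T"
  shows "heat (\<lambda>y. ennreal (m y powr \<alpha>)) x t \<le> ennreal (smoothing_constant * \<gamma> powr \<alpha> * t powr (- \<alpha> / (p - 1)))"
proof -
  define r where "r = t powr (1 / \<theta>)"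
  have r: "0 < r" using t by (simp add: r_def)
  \<comment> \<open>For infinite \<open>T\<close> the range of admissible radii is unbounded, by the
    convention in \<open>ennpowr\<close>.\<close>
  have rT: "ennreal r < ennpowr T (1 / \<theta>)"
    using t \<theta> by (cases T) (auto simp: ennpowr_ennreal r_def ennreal_less_iff intro!: powr_less_mono2)
  define b where "b = \<gamma> * r powr (- \<theta> / (p - 1))"
  have b: "0 \<le> b" using \<gamma> by (simp add: b_def)
  have ba: "b powr \<alpha> = \<gamma> powr \<alpha> * t powr (- \<alpha> / (p - 1))"
    using t \<gamma> \<theta> by (simp add: b_def r_def powr_mult powr_powr)
  have le: "(\<integral>\<^sup>+y. indicator (ball z r) y * ennreal (m y powr \<alpha>) \<partial>lborel) \<le> ennreal (b powr \<alpha>) * emeasure lborel (ball z r)" for z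
  proof -
    define I where "I = (\<integral>\<^sup>+y. indicator (ball z r) y * ennreal (m y powr \<alpha>) \<partial>lborel)"
    define V where "V = emeasure lborel (ball z r)"
    \<comment> \<open>Positive finite volume allows the division in the average to be undone in
      [0,infinity].\<close>
    have V: "V \<noteq> 0" "V \<noteq> \<top>" using r unit_ball_vol_pos[of "real CARD('n)"] by (auto simp: V_def emeasure_ball simp del: unit_ball_vol_pos)
    have "(\<integral>\<^sup>+y\<in>ball z r. ennreal (\<mu> y powr \<alpha>) \<partial>lebesgue) = I"
      unfolding I_def nn_integral_completion using ae
      by (intro nn_integral_cong_AE) (auto simp: mult.commute)
    then have "ennpowr (I / V) (1 / \<alpha>) \<le> ennreal b"
      using SUP_upper[of z UNIV "\<lambda>z. ennpowr ((\<integral>\<^sup>+y\<in>ball z r. ennreal (\<mu> y powr \<alpha>) \<partial>lebesgue) / emeasure lebesgue (ball z r)) (1 / \<alpha>)"]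
        averages[OF r rT] unfolding b_def[symmetric] V_def by simp
    then have "ennpowr (ennpowr (I / V) (1 / \<alpha>)) \<alpha> \<le> ennpowr (ennreal b) \<alpha>"
      using \<alpha> by (intro ennpowr_mono) auto
    then have "I / V \<le> ennreal (b powr \<alpha>)"
      using \<alpha> b by (simp add: ennpowr_ennpowr ennpowr_ennreal)
    then have "I / V * V \<le> ennreal (b powr \<alpha>) * V" by (rule mult_right_mono) simp
    moreover have "I / V * V = I" using V by (metis ennreal_times_divide mult.commute ennreal_mult_divide_eq)
    ultimately show ?thesis by (simp add: I_def V_def)
  qed
  have "heat (\<lambda>y. ennreal (m y powr \<alpha>)) x t \<le> ennreal (smoothing_constant * (b powr \<alpha>))"
    unfolding heat_def kernel_eq[OF t(1)]
    by (rule smoothing[OF t(1)]) (use le in \<open>auto simp: r_def\<close>)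
  then show ?thesis by (simp add: ba mult.assoc)
qed

lemma existence:
  assumes \<alpha>: "1 < \<alpha>" "\<alpha> < p"
  shows "\<exists>\<gamma>>0. \<forall>(\<mu> :: real ^ 'n \<Rightarrow> real) (T :: ennreal).
           \<mu> \<in> borel_measurable lebesgue \<longrightarrow>
           (\<forall>x. 0 \<le> \<mu> x) \<longrightarrow>
           0 < T \<longrightarrow>
           (\<forall>\<sigma>::real. 0 < \<sigma> \<longrightarrow> ennreal \<sigma> < ennpowr T (1 / \<theta>) \<longrightarrow>
              (SUP z. ennpowr ((\<integral>\<^sup>+y\<in>ball z \<sigma>. ennreal (\<mu> y powr \<alpha>) \<partial>lebesgue)
                                 / emeasure lebesgue (ball z \<sigma>)) (1 / \<alpha>))
                \<le> ennreal (\<gamma> * \<sigma> powr (- \<theta> / (p - 1)))) \<longrightarrow>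
           (\<exists>u. is_solution G p (density lebesgue (\<lambda>y. ennreal (\<mu> y))) T u)"
proof -
  \<comment> \<open>\<open>A\<close> is chosen to give equality in the smallness condition B
    A^((p-1)/\<alpha>) \<le> 1 of \<open>supersolution\<close>, and \<gamma> so that the smoothing
    estimate yields precisely \<open>A\<close>. Neither depends on \<mu> or
    \<open>T\<close>.\<close>
  define B where "B = 2 powr p * ((p - 1) / (\<alpha> - 1))"
  define A where "A = B powr (- \<alpha> / (p - 1))"
  define \<gamma> where "\<gamma> = (A / smoothing_constant) powr (1 / \<alpha>)"
  have B: "0 < B" using \<alpha> by (simp add: B_def)
  then have A: "0 < A" by (simp add: A_def)
  have \<gamma>: "0 < \<gamma>" using A smoothing_constant_pos by (simp add: \<gamma>_def)
  have "A powr ((p - 1) / \<alpha>) = inverse B"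
    unfolding A_def powr_powr using \<alpha> B by (simp add: powr_minus)
  then have small: "2 powr p * ((p - 1) / (\<alpha> - 1)) * A powr ((p - 1) / \<alpha>) \<le> 1"
    unfolding B_def[symmetric] using B by simp
  have C\<gamma>: "smoothing_constant * \<gamma> powr \<alpha> = A"
    using \<alpha> A smoothing_constant_pos by (simp add: \<gamma>_def powr_powr)
  show ?thesis
  proof (intro exI[of _ \<gamma>] conjI allI impI \<gamma>)
    fix \<mu> :: "real ^ 'n \<Rightarrow> real" and T :: ennreal
    assume \<mu>: "\<mu> \<in> borel_measurable lebesgue" "\<forall>x. 0 \<le> \<mu> x"
      and averages: "\<forall>\<sigma>::real. 0 < \<sigma> \<longrightarrow> ennreal \<sigma> < ennpowr T (1 / \<theta>) \<longrightarrow>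
              (SUP z. ennpowr ((\<integral>\<^sup>+y\<in>ball z \<sigma>. ennreal (\<mu> y powr \<alpha>) \<partial>lebesgue)
                                 / emeasure lebesgue (ball z \<sigma>)) (1 / \<alpha>))
                \<le> ennreal (\<gamma> * \<sigma> powr (- \<theta> / (p - 1)))"
    obtain m where m[measurable]: "m \<in> borel_measurable borel" and m0: "\<And>x. 0 \<le> m x"
      and ae: "AE x in lborel. \<mu> x = m x"
      using completion_ex_borel_measurable_nonneg[OF \<mu>(1)] \<mu>(2) by auto
    define W where "W = heat (\<lambda>y. ennreal (m y powr \<alpha>))"
    have W: "W x t \<le> ennreal (A * t powr (- \<alpha> / (p - 1)))" if "0 < t" "ennreal t < T" for x t
      unfolding W_def C\<gamma>[symmetric]
      by (rule heat_le_of_ball_averages[OF \<alpha> m ae \<gamma> _ that]) (use averages in blast)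
    define v where "v = (\<lambda>(y, s). 2 * ennpowr (W y s) (1 / \<alpha>))"
    have fin: "v (x, t) < \<top>" if "0 < t" "ennreal t < T" for x t
    proof -
      have "W x t \<le> ennreal (A * t powr (- \<alpha> / (p - 1)))" by (rule W[OF that])
      then obtain r where "0 \<le> r" "W x t = ennreal r"
        by (cases "W x t") (auto simp: top_unique)
      then show ?thesis by (simp add: v_def ennpowr_ennreal ennreal_mult_less_top)
    qed
    have super: "heat (\<lambda>y. ennreal (m y)) x t + duhamel p v (x, t) \<le> v (x, t)"
      if "0 < t" "ennreal t < T" for x t
      using supersolution[OF \<alpha> m m0 A small W[unfolded W_def] that]
      by (simp add: v_def W_def)
    have "0 < p" using \<alpha> by simp
    then obtain u where u: "u \<in> borel_measurable borel"
        "\<And>x t. u (x, t) = heat (\<lambda>y. ennreal (m y)) x t + duhamel p u (x, t)"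
        "\<And>x t. 0 < t \<Longrightarrow> ennreal t < T \<Longrightarrow> u (x, t) \<le> v (x, t)"
      by (rule solution_below_supersolution[of p "\<lambda>y. ennreal (m y)" T v]) (use super in auto)
    have "is_solution G p (density lebesgue (\<lambda>y. ennreal (\<mu> y))) T u"
      using \<mu> by (intro is_solution_borelI[OF _ _ m ae u(1,2)]) (auto intro: le_less_trans[OF u(3) fin])
    then show "\<exists>u. is_solution G p (density lebesgue (\<lambda>y. ennreal (\<mu> y))) T u" by blast
  qed
qed

end

theorem theorem1p4:
  fixes G :: "(real ^ 'n) \<times> real \<Rightarrow> real"
    and \<theta> \<alpha> p :: real
  assumes "0 < \<theta>" and "\<theta> \<le> 2"
    and "1 < \<alpha>" and "\<alpha> < p"
    and "fundamental_solution \<theta> G"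
  shows "\<exists>\<gamma>\<^sub>3>0. \<forall>(\<mu> :: real ^ 'n \<Rightarrow> real) (T :: ennreal).
           \<mu> \<in> borel_measurable lebesgue \<longrightarrow>
           (\<forall>x. 0 \<le> \<mu> x) \<longrightarrow>
           0 < T \<longrightarrow>
           (\<forall>\<sigma>::real. 0 < \<sigma> \<longrightarrow> ennreal \<sigma> < ennpowr T (1 / \<theta>) \<longrightarrow>
              (SUP z. ennpowr ((\<integral>\<^sup>+y\<in>ball z \<sigma>. ennreal (\<mu> y powr \<alpha>) \<partial>lebesgue)
                                 / emeasure lebesgue (ball z \<sigma>)) (1 / \<alpha>))
                \<le> ennreal (\<gamma>\<^sub>3 * \<sigma> powr (- \<theta> / (p - 1)))) \<longrightarrow>
           (\<exists>u. is_solution G p (density lebesgue (\<lambda>y. ennreal (\<mu> y))) T u)"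
proof -
  interpret fractional_heat_kernel \<theta> G
    using assms by unfold_locales
  show ?thesis by (rule existence[OF assms(3,4)])
qed

end
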